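(* Let $p=(p_\pi)_{\pi\in B(\pi_\kappa)}$ be a probability distribution on $B(\pi_\kappa)$ with $p_\pi>0$ for every $\pi\in B(\pi_\kappa)$, and let $\mathbb{P}=p^{\otimes\mathbb{Z}_{\geq0}}$ be the associated product probability on the space $\Omega$ of infinite trajectories. The following assertions are equivalent: (i) The probability distribution $\mathbb{P}$ is central. (ii) There exists an $n$-tuple $\tau=(\tau_1,\ldots,\tau_n)\in]0,+\infty[^n$ such that for each arrow $\pi\overset{i}{\rightarrow}\pi'$ in $B(\pi_\kappa)$ one has $p_{\pi'}=p_\pi\times\tau_i$.
   Context: Lie-theoretic setting: $\mathfrak{g}$ is a simple finite-dimensional Lie algebra over $\mathbb{C}$ of rank $n$ with simple roots $\alpha_1,\ldots,\alpha_n$ realized in $\mathbb{R}^n$ with a Weyl-group-invariant scalar product $\langle\cdot,\cdot\rangle$; $\alpha^\vee=2\alpha/\langle\alpha,\alpha\rangle$; $\omega_1,\ldots,\omega_n$ are the fundamental weights, $P=\bigoplus_i\mathbb{Z}\omega_i$, $P_+=\bigoplus_i\mathbb{Z}_{\geq0}\omega_i$, and $\mathcal{C}=\{x\in\mathbb{R}^n\mid\langle x,\alpha_i^\vee\rangle\geq0\ \forall i\}$. Littelmann paths: an elementary path is a continuous piecewise linear map $\pi:[0,1]\to\mathbb{R}^n$ with $\pi(0)=0$, $\pi(1)\in P$ and rational turning points; its weight is $\mathrm{wt}(\pi)=\pi(1)$. For a path $\eta:[0,T]\to\mathbb{R}^n$ set $h_i(t)=\langle\eta(t),\alpha_i^\vee\rangle$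 and $M_i=\min_{[0,T]}h_i$ (an integer for all paths considered). The root operators are: $\tilde f_i(\eta)=\mathbf{0}$ if $h_i(T)=M_i$, otherwise $\tilde f_i(\eta)(t)=\eta(t)-\min\{1,\inf_{s\in[t,T]}h_i(s)-M_i\}\alpha_i$; $\tilde e_i(\eta)=\mathbf{0}$ if $M_i=0$, otherwise $\tilde e_i(\eta)(t)=\eta(t)-\min\{0,\inf_{s\in[0,t]}h_i(s)-M_i-1\}\alpha_i$. Fix $\kappa\in P_+$ and an elementary path $\pi_\kappa$ from $0$ to $\kappa$ with image in $\mathcal{C}$. $B(\pi_\kappa)$ is the finite set of all (nonzero) paths obtained from $\pi_\kappa$ by applying the operators $\tilde f_i$; it is a colored oriented graph with an arrow $\pi\overset{i}{\rightarrow}\pi'$ iff $\tilde f_i(\pi)=\pi'$. Trajectories: for $\ell\geq1$, $B(\pi_\kappa)^{\otimes\ell}$ is the set of paths $b=\pi_1\otimes\cdots\otimes\pi_\ell$ with $\pi_k\in B(\pi_\kappa)$, obtained by concatenation ($b(t)=\pi_1(1)+\cdots+\pi_k(1)+\pi_{k+1}(t-k)$ for $t\in[k,k+1]$), with weight $\mathrm{wt}(b)=\pi_1(1)+\cdots+\pi_\ell(1)$. $\Omega$ is the set of infinite sequences $\omega=(\pi_\ell)_{\ell\geq1}$ in $B(\pi_\kappa)$, $\Pi_\ell(\omega)=\pi_1\otimes\cdots\otimes\pi_\ell$, and $\mathbb{P}=p^{\otimes\mathbb{Z}_{\geq0}}$ is the product probability (coordinates i.i.d. with law $p$). For $b\in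 B(\pi_\kappa)^{\otimes\ell}$, $U_b=\{\omega\in\Omega\mid\Pi_\ell(\omega)=b\}$. $\mathbb{P}$ is called central when for any $\ell\geq1$ and any $b,b'\in B(\pi_\kappa)^{\otimes\ell}$ with $\mathrm{wt}(b)=\mathrm{wt}(b')$ one has $\mathbb{P}(U_b)=\mathbb{P}(U_{b'})$. *)

theory Defs
  imports "HOL-Probability.Probability"
begin

section \<open>Root systems, weights and the dominant chamber\<close>

text \<open>
  The root systems of the simple finite-dimensional complex Lie algebras of rank \<open>n\<close> are the
  irreducible reduced crystallographic root systems of rank \<open>n\<close>.  The ambient \<open>n\<close>-dimensional real
  space with its Weyl-invariant scalar product is a Euclidean space; the scalar product is the
  class operation \<open>\<bullet>\<close>, which is invariant because the Weyl group is generated by reflections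
  that are orthogonal for it.
\<close>

definition coroot :: "'v::euclidean_space \<Rightarrow> 'v"
  where "coroot \<alpha> = (2 / (\<alpha> \<bullet> \<alpha>)) *\<^sub>R \<alpha>"

definition root_reflection :: "'v::euclidean_space \<Rightarrow> 'v \<Rightarrow> 'v"
  where "root_reflection \<alpha> x = x - (x \<bullet> coroot \<alpha>) *\<^sub>R \<alpha>"

definition root_system :: "'v::euclidean_space set \<Rightarrow> bool"
  where "root_system \<Phi> \<longleftrightarrow>
    finite \<Phi> \<and> span \<Phi> = UNIV \<and> 0 \<notin> \<Phi> \<and>
    (\<forall>\<alpha>\<in>\<Phi>. \<forall>\<beta>\<in>\<Phi>. root_reflection \<alpha> \<beta> \<in> \<Phi>) \<and>
    (\<forall>\<alpha>\<in>\<Phi>. \<forall>\<beta>\<in>\<Phi>. \<beta> \<bullet> coroot \<alpha> \<in> \<int>) \<and>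
    (\<forall>\<alpha>\<in>\<Phi>. \<forall>c. c *\<^sub>R \<alpha> \<in> \<Phi> \<longrightarrow> c = 1 \<or> c = -1)"

definition irreducible_root_system :: "'v::euclidean_space set \<Rightarrow> bool"
  where "irreducible_root_system \<Phi> \<longleftrightarrow>
    root_system \<Phi> \<and> \<Phi> \<noteq> {} \<and>
    \<not> (\<exists>\<Phi>1 \<Phi>2. \<Phi>1 \<noteq> {} \<and> \<Phi>2 \<noteq> {} \<and> \<Phi> = \<Phi>1 \<union> \<Phi>2 \<and> (\<forall>\<alpha>\<in>\<Phi>1. \<forall>\<beta>\<in>\<Phi>2. \<alpha> \<bullet> \<beta> = 0))"

text \<open>The index type \<open>'n\<close> of the simple roots plays the role of \<open>{1,\<dots>,n}\<close>.\<close>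

definition simple_roots :: "'v::euclidean_space set \<Rightarrow> ('n::finite \<Rightarrow> 'v) \<Rightarrow> bool"
  where "simple_roots \<Phi> \<alpha> \<longleftrightarrow>
    inj \<alpha> \<and> range \<alpha> \<subseteq> \<Phi> \<and> independent (range \<alpha>) \<and>
    (\<forall>\<beta>\<in>\<Phi>. \<exists>c :: 'n \<Rightarrow> nat.
       \<beta> = (\<Sum>i\<in>UNIV. of_nat (c i) *\<^sub>R \<alpha> i) \<or> \<beta> = - (\<Sum>i\<in>UNIV. of_nat (c i) *\<^sub>R \<alpha> i))"

definition fundamental_weight :: "('n::finite \<Rightarrow> 'v::euclidean_space) \<Rightarrow> 'n \<Rightarrow> 'v"
  where "fundamental_weight \<alpha> i =
    (THE w. \<forall>j. w \<bullet> coroot (\<alpha> j) = (if j = i then 1 else 0))"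

definition weight_lattice :: "('n::finite \<Rightarrow> 'v::euclidean_space) \<Rightarrow> 'v set"
  where "weight_lattice \<alpha> =
    range (\<lambda>c :: 'n \<Rightarrow> int. \<Sum>i\<in>UNIV. of_int (c i) *\<^sub>R fundamental_weight \<alpha> i)"

definition dominant_weights :: "('n::finite \<Rightarrow> 'v::euclidean_space) \<Rightarrow> 'v set"
  where "dominant_weights \<alpha> =
    range (\<lambda>c :: 'n \<Rightarrow> nat. \<Sum>i\<in>UNIV. of_nat (c i) *\<^sub>R fundamental_weight \<alpha> i)"

definition rational_weights :: "('n::finite \<Rightarrow> 'v::euclidean_space) \<Rightarrow> 'v set"
  where "rational_weights \<alpha> =
    range (\<lambda>c :: 'n \<Rightarrow> rat. \<Sum>i\<in>UNIV. of_rat (c i) *\<^sub>R fundamental_weight \<alpha> i)"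

definition dominant_chamber :: "('n::finite \<Rightarrow> 'v::euclidean_space) \<Rightarrow> 'v set"
  where "dominant_chamber \<alpha> = {x. \<forall>i. 0 \<le> x \<bullet> coroot (\<alpha> i)}"


section \<open>Littelmann paths\<close>

text \<open>
  A path of length \<open>T\<close> is a function on \<open>{0..T}\<close>, represented by a total function that is
  \<^const>\<open>undefined\<close> outside this interval (\<^const>\<open>extensional\<close>), so that equality of functions is
  equality of paths.
\<close>

type_synonym 'v lpath = "real \<Rightarrow> 'v"

text \<open>
  The points \<open>t k\<close> subdivide the unit interval into pieces on which the path is affine.
  "Rational turning points" means that the path turns only at points of the rational span of the
  weight lattice.
\<close>

definition elementary_path :: "('n::finite \<Rightarrow> 'v::euclidean_space) \<Rightarrow> 'v lpath \<Rightarrow> bool"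
  where "elementary_path \<alpha> \<pi> \<longleftrightarrow>
    \<pi> \<in> extensional {0..1} \<and> continuous_on {0..1} \<pi> \<and>
    \<pi> 0 = 0 \<and> \<pi> 1 \<in> weight_lattice \<alpha> \<and>
    (\<exists>(m::nat) t :: nat \<Rightarrow> real. t 0 = 0 \<and> t m = 1 \<and>
       (\<forall>k<m. t k < t (Suc k) \<and>
          (\<exists>v. \<forall>s\<in>{t k..t (Suc k)}. \<pi> s = \<pi> (t k) + (s - t k) *\<^sub>R v)) \<and>
       (\<forall>k\<le>m. \<pi> (t k) \<in> rational_weights \<alpha>))"

definition path_height :: "('n \<Rightarrow> 'v::euclidean_space) \<Rightarrow> 'n \<Rightarrow> 'v lpath \<Rightarrow> real \<Rightarrow> real"
  where "path_height \<alpha> i \<eta> t = \<eta> t \<bullet> coroot (\<alpha> i)"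

definition min_height :: "('n \<Rightarrow> 'v::euclidean_space) \<Rightarrow> real \<Rightarrow> 'n \<Rightarrow> 'v lpath \<Rightarrow> real"
  where "min_height \<alpha> T i \<eta> = (INF t\<in>{0..T}. path_height \<alpha> i \<eta> t)"

text \<open>The value \<^const>\<open>None\<close> stands for the symbol \<open>\<^bold>0\<close>; \<open>T\<close> is the length of the path.\<close>

definition root_f ::
  "('n \<Rightarrow> 'v::euclidean_space) \<Rightarrow> real \<Rightarrow> 'n \<Rightarrow> 'v lpath \<Rightarrow> 'v lpath option"
  where "root_f \<alpha> T i \<eta> =
    (if path_height \<alpha> i \<eta> T = min_height \<alpha> T i \<eta> then None
     else Some (\<lambda>t\<in>{0..T}. \<eta> t -
       min 1 ((INF s\<in>{t..T}. path_height \<alpha> i \<eta> s) - min_height \<alpha> T i \<eta>) *\<^sub>R \<alpha> i))"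

inductive_set path_crystal :: "('n \<Rightarrow> 'v::euclidean_space) \<Rightarrow> 'v lpath \<Rightarrow> 'v lpath set"
  for \<alpha> :: "'n \<Rightarrow> 'v" and \<pi>\<^sub>0 :: "'v lpath"
  where
    start: "\<pi>\<^sub>0 \<in> path_crystal \<alpha> \<pi>\<^sub>0"
  | step: "\<eta> \<in> path_crystal \<alpha> \<pi>\<^sub>0 \<Longrightarrow> root_f \<alpha> 1 i \<eta> = Some \<eta>' \<Longrightarrow> \<eta>' \<in> path_crystal \<alpha> \<pi>\<^sub>0"


section \<open>Random trajectories\<close>

text \<open>
  The concatenation of the first \<open>l\<close> terms of \<open>\<omega>\<close>, numbered from \<open>0\<close>.  For \<open>0 < t \<le> l\<close> the index
  \<open>k\<close> is the one with \<open>k < t \<le> k + 1\<close>, and \<open>k = 0\<close> for \<open>t = 0\<close>, so that \<open>k < l\<close> when \<open>l > 0\<close>.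
\<close>

definition trajectory :: "nat \<Rightarrow> (nat \<Rightarrow> 'v::euclidean_space lpath) \<Rightarrow> 'v lpath"
  where "trajectory l \<omega> =
    (\<lambda>t\<in>{0..real l}. let k = nat (\<lceil>t\<rceil> - 1) in (\<Sum>j<k. \<omega> j 1) + \<omega> k (t - real k))"

definition trajectories :: "'v::euclidean_space lpath set \<Rightarrow> nat \<Rightarrow> 'v lpath set"
  where "trajectories B l = trajectory l ` ({..<l} \<rightarrow> B)"

definition infinite_trajectories :: "'v::euclidean_space lpath set \<Rightarrow> (nat \<Rightarrow> 'v lpath) set"
  where "infinite_trajectories B = (UNIV \<rightarrow> B)"

definition cylinder ::
  "'v::euclidean_space lpath set \<Rightarrow> nat \<Rightarrow> 'v lpath \<Rightarrow> (nat \<Rightarrow> 'v lpath) set"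
  where "cylinder B l b = {\<omega> \<in> infinite_trajectories B. trajectory l \<omega> = b}"

text \<open>
  For \<open>p\<close> supported in \<open>B\<close> this measure on all sequences of paths is carried by
  \<open>infinite_trajectories B\<close>.
\<close>

definition product_law :: "'v::euclidean_space lpath pmf \<Rightarrow> (nat \<Rightarrow> 'v lpath) measure"
  where "product_law p = Pi\<^sub>M UNIV (\<lambda>_. measure_pmf p)"

text \<open>The weight of the trajectory \<open>b\<close> of length \<open>l\<close> is its endpoint \<open>b l\<close>.\<close>

definition central ::
  "'v::euclidean_space lpath set \<Rightarrow> (nat \<Rightarrow> 'v lpath) measure \<Rightarrow> bool"
  where "central B M \<longleftrightarrow>
    (\<forall>l\<ge>1. \<forall>b\<in>trajectories B l. \<forall>b'\<in>trajectories B l.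
       b (real l) = b' (real l) \<longrightarrow> measure M (cylinder B l b) = measure M (cylinder B l b'))"

end

theory Submission
  imports Defs
begin

text \<open>
  Concatenation being injective, centrality says that products of the weights \<open>p\<close> depend only on the
  sum of the endpoints. If every arrow \<open>\<pi> \<rightarrow>\<^sub>i \<pi>'\<close> lowers the endpoint by exactly \<open>\<alpha>\<^sub>i\<close>, then comparing
  \<open>\<pi> \<otimes> \<zeta>'\<close> with \<open>\<pi>' \<otimes> \<zeta>\<close> for two \<open>i\<close>-arrows gives \<open>\<tau>\<^sub>i\<close>, and conversely \<open>p\<close> is, up to a constant, a monomial
  in \<open>\<tau>\<close> whose exponents are read off the endpoint.

  The substance is that arrows do lower the endpoint by \<open>\<alpha>\<^sub>i\<close>, that is, that the minima of the heights
  are integers on the whole crystal (Littelmann). For a pair \<open>i \<noteq> j\<close> consider the nested infima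
  \<open>inf {d\<^sub>1 h\<^sub>i(s\<^sub>1) + d\<^sub>2 h\<^sub>j(s\<^sub>2) + d\<^sub>3 h\<^sub>i(s\<^sub>3) + \<dots> | s\<^sub>1 \<le> s\<^sub>2 \<le> \<dots> \<le> s\<^sub>k}\<close>, where the \<open>d\<^sub>r\<close> satisfy the Chebyshev
  recursion of the Cartan matrix, which reaches \<open>d\<^sub>m = 0\<close> in the finite types. Integrality of all of them
  is stable under \<open>f\<^sub>i\<close> and \<open>f\<^sub>j\<close>, and it is stable under time reversal, hence also under the inverse
  operators. The infima of full length \<open>m - 1\<close>, taken up to time \<open>t\<close>, determine the dominant path from
  which the given one is generated and the number of steps needed. This settles rank two, and in
  general an operator \<open>f\<^sub>l\<close> with \<open>l \<notin> {i, j}\<close> is handled by going back along \<open>i\<close> within the rank two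
  crystal of \<open>{i, l}\<close>, by induction on the number of steps from \<open>\<pi>\<^sub>\<kappa>\<close>.
\<close>

subsection \<open>Infima over intervals\<close>

text \<open>Infima are compared below through their lower bounds, which lets nested infima be
  exchanged as quantifiers. The case \<open>d = 0\<close> is included because the coefficients of
  the chains eventually vanish.\<close>

lemma le_mult_cINF_iff:
  fixes f :: "'a \<Rightarrow> real"
  assumes "A \<noteq> {}" "bdd_below (f ` A)" "0 \<le> d"
  shows "x \<le> d * (INF s\<in>A. f s) \<longleftrightarrow> (\<forall>s\<in>A. x \<le> d * f s)"
proof (cases "d = 0")
  case True
  then show ?thesis using assms(1) by auto
next
  case False
  then have d: "d > 0" using assms(3) by simp
  have *: "x \<le> d * y \<longleftrightarrow> x / d \<le> y" for y
    using d by (simp add: field_simps)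
  show ?thesis
    unfolding * using le_cINF_iff[OF assms(1,2)] .
qed

lemma bdd_below_image_mono:
  assumes "bdd_below (f ` B)" "A \<subseteq> B"
  shows "bdd_below (f ` A)"
  using assms by (meson bdd_below_mono image_mono)

lemma bdd_below_continuous_on_Icc:
  fixes h :: "real \<Rightarrow> real"
  assumes "continuous_on {0..1} h"
  shows "bdd_below (h ` {0..1})"
  by (meson assms bounded_imp_bdd_below compact_Icc compact_continuous_image compact_imp_bounded)

text \<open>The tail infimum inherits the modulus of uniform continuity of \<open>h\<close>: a point
  of one tail is moved into the other tail by at most the distance of their left ends.\<close>

lemma continuous_on_inf_tail:
  fixes h :: "real \<Rightarrow> real"
  assumes h: "continuous_on {0..1} h"
  shows "continuous_on {0..1} (\<lambda>t. INF s\<in>{t..1}. h s)"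
proof -
  note bdd = bdd_below_continuous_on_Icc[OF h]
  have uc: "uniformly_continuous_on {0..1} h"
    by (simp add: compact_uniformly_continuous h)
  have le: "(INF s\<in>{t..1}. h s) \<le> (INF s\<in>{u..1}. h s) + e"
    if t: "t \<in> {0..1}" and u: "u \<in> {0..1}"
      and e: "\<And>x y. x \<in> {0..1} \<Longrightarrow> y \<in> {0..1} \<Longrightarrow> \<bar>x - y\<bar> \<le> \<bar>t - u\<bar> \<Longrightarrow> \<bar>h x - h y\<bar> \<le> e"
    for t u e
  proof -
    have "(INF s\<in>{t..1}. h s) - e \<le> (INF s\<in>{u..1}. h s)"
    proof (rule cINF_greatest)
      fix s assume s: "s \<in> {u..1}"
      \<comment> \<open>\<open>max s t\<close> lies in the tail from \<open>t\<close> and within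
        \<open>\<bar>t - u\<bar>\<close> of \<open>s\<close>.\<close>
      have "(INF s\<in>{t..1}. h s) \<le> h (max s t)"
        using s t by (intro cINF_lower bdd_below_image_mono[OF bdd]) auto
      moreover have "\<bar>h (max s t) - h s\<bar> \<le> e"
        using s t u by (intro e) (auto simp: max_def)
      ultimately show "(INF s\<in>{t..1}. h s) - e \<le> h s" by linarith
    qed (use u in auto)
    then show ?thesis by simp
  qed
  show ?thesis
    unfolding continuous_on_iff
  proof (intro ballI allI impI)
    fix t e :: real assume t: "t \<in> {0..1}" and e: "0 < e"
    then have "0 < e / 2" by simp
    then obtain d where d: "d > 0"
      "\<And>x y. x \<in> {0..1} \<Longrightarrow> y \<in> {0..1} \<Longrightarrow> dist y x < d \<Longrightarrow> dist (h y) (h x) < e / 2"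
      using uc unfolding uniformly_continuous_on_def by metis
    show "\<exists>d>0. \<forall>u\<in>{0..1}. dist u t < d \<longrightarrow>
            dist (INF s\<in>{u..1}. h s) (INF s\<in>{t..1}. h s) < e"
    proof (intro exI[of _ d] conjI ballI impI d(1))
      fix u :: real assume u: "u \<in> {0..1}" "dist u t < d"
      have *: "\<bar>h x - h y\<bar> \<le> e / 2" if "x \<in> {0..1}" "y \<in> {0..1}" "\<bar>x - y\<bar> \<le> \<bar>t - u\<bar>" for x y
      proof -
        have "dist x y < d" using that(3) u(2) by (simp add: dist_real_def)
        then show ?thesis using d(2)[OF that(2,1)] by (simp add: dist_real_def)
      qed
      have "(INF s\<in>{t..1}. h s) \<le> (INF s\<in>{u..1}. h s) + e / 2"
        by (rule le[OF t u(1) *]) auto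
      moreover have "(INF s\<in>{u..1}. h s) \<le> (INF s\<in>{t..1}. h s) + e / 2"
        by (rule le[OF u(1) t *]) auto
      ultimately show "dist (INF s\<in>{u..1}. h s) (INF s\<in>{t..1}. h s) < e"
        using e by (simp add: dist_real_def)
    qed
  qed
qed

text \<open>For \<open>h\<close> the height along \<open>i\<close> of a path of length 1, this is
  the multiple of \<open>\<alpha> i\<close> that the root operator subtracts at time
  \<open>t\<close>.\<close>

definition cutoff :: "(real \<Rightarrow> real) \<Rightarrow> real \<Rightarrow> real"
  where "cutoff h t = min 1 ((INF s\<in>{t..1}. h s) - (INF s\<in>{0..1}. h s))"

lemma continuous_on_cutoff:
  assumes "continuous_on {0..1} h"
  shows "continuous_on {0..1} (cutoff h)"
  unfolding cutoff_def using continuous_on_inf_tail[OF assms]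
  by (intro continuous_intros)

lemma inf_tail_le:
  fixes h :: "real \<Rightarrow> real"
  assumes "continuous_on {0..1} h" "0 \<le> t" "t \<le> s" "s \<le> 1"
  shows "(INF u\<in>{t..1}. h u) \<le> h s"
  using assms by (intro cINF_lower bdd_below_image_mono[OF bdd_below_continuous_on_Icc[OF assms(1)]]) auto

lemma inf_tail_mono:
  fixes h :: "real \<Rightarrow> real"
  assumes "continuous_on {0..1} h" "0 \<le> t" "t \<le> s" "s \<le> 1"
  shows "(INF u\<in>{t..1}. h u) \<le> (INF u\<in>{s..1}. h u)"
  using assms by (intro cINF_greatest inf_tail_le) auto

lemma cutoff_nonneg:
  assumes "continuous_on {0..1} h" "0 \<le> t" "t \<le> 1"
  shows "0 \<le> cutoff h t"
  using inf_tail_mono[OF assms(1), of 0 t] assms by (simp add: cutoff_def)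

lemma cutoff_mono:
  assumes "continuous_on {0..1} h" "0 \<le> t" "t \<le> s" "s \<le> 1"
  shows "cutoff h t \<le> cutoff h s"
  using inf_tail_mono[OF assms] by (simp add: cutoff_def)

lemma cutoff_0 [simp]: "cutoff h 0 = 0"
  by (simp add: cutoff_def)

lemma Icc_attains_inf:
  fixes h :: "real \<Rightarrow> real"
  assumes "continuous_on {0..1} h" "0 \<le> a" "a \<le> b" "b \<le> 1"
  obtains v where "a \<le> v" "v \<le> b" "h v = (INF s\<in>{a..b}. h s)"
proof -
  have "continuous_on {a..b} h"
    using assms by (auto intro: continuous_on_subset)
  then obtain v where v: "v \<in> {a..b}" "\<forall>y\<in>{a..b}. h v \<le> h y"
    using continuous_attains_inf[of "{a..b}" h] assms(3) by auto
  then have "h v = (INF s\<in>{a..b}. h s)"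
    by (intro antisym cINF_greatest cINF_lower bdd_below_image_mono[OF bdd_below_continuous_on_Icc[OF assms(1)]])
       (use assms in auto)
  with v(1) that show ?thesis by auto
qed

text \<open>The point of this identity is that the correction sits at the two ends of the interval only,
  so that it telescopes in nested infima.\<close>

lemma inf_minus_cutoff:
  fixes h :: "real \<Rightarrow> real"
  assumes h: "continuous_on {0..1} h" and ab: "0 \<le> a" "a \<le> b" "b \<le> 1"
  shows "(INF s\<in>{a..b}. h s - 2 * cutoff h s) = (INF s\<in>{a..b}. h s) - cutoff h a - cutoff h b"
proof -
  define g where "g = cutoff h"
  define m where "m = (INF s\<in>{a..b}. h s)"
  define M where "M = (INF s\<in>{0..1}. h s)"
  define I where "I t = (INF s\<in>{t..1}. h s)" for t
  have g: "g t = min 1 (I t - M)" for t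
    by (simp add: g_def cutoff_def I_def M_def)
  have gmono: "g t \<le> g s" if "0 \<le> t" "t \<le> s" "s \<le> 1" for t s
    unfolding g_def by (rule cutoff_mono[OF h that])
  have I_le: "I t \<le> h s" if "0 \<le> t" "t \<le> s" "s \<le> 1" for t s
    unfolding I_def by (rule inf_tail_le[OF h that])
  have Imono: "I t \<le> I s" if "0 \<le> t" "t \<le> s" "s \<le> 1" for t s
    unfolding I_def by (rule inf_tail_mono[OF h that])
  have m_le: "m \<le> h s" if "a \<le> s" "s \<le> b" for s
    unfolding m_def using that ab
    by (intro cINF_lower bdd_below_image_mono[OF bdd_below_continuous_on_Icc[OF h]]) auto
  obtain v where v: "a \<le> v" "v \<le> b" "h v = m"
    unfolding m_def by (rule Icc_attains_inf[OF h ab])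
  obtain w where w: "a \<le> w" "w \<le> 1" "h w = I a"
    unfolding I_def by (rule Icc_attains_inf[OF h, of a 1]) (use ab in auto)
  have lower: "m - g a - g b \<le> h s - 2 * g s" if s: "a \<le> s" "s \<le> b" for s
  proof -
    \<comment> \<open>Either the infimum of the tail from \<open>a\<close> is attained by time
      \<open>s\<close>, and \<open>g\<close> grows no faster than \<open>I\<close>; or it is
      attained later, so that neither \<open>I\<close> nor \<open>g\<close> has grown between
      \<open>a\<close> and \<open>s\<close>.\<close>
    have "g s - g a \<le> h s - m"
    proof (cases "w \<le> s")
      case True
      then have "m \<le> I a" using m_le[of w] w s by simp
      moreover have "g s - g a \<le> I s - I a"
        using Imono[of a s] s ab unfolding g by auto
      moreover have "I s \<le> h s" using I_le[of s s] s ab by simp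
      ultimately show ?thesis by linarith
    next
      case False
      then have "I s \<le> I a" using I_le[of s w] w s ab by simp
      then have "g s \<le> g a" unfolding g by auto
      then show ?thesis using m_le[OF s] by linarith
    qed
    then show ?thesis using gmono[of s b] s ab by linarith
  qed
  have "\<exists>s. a \<le> s \<and> s \<le> b \<and> h s - 2 * g s \<le> m - g a - g b"
  proof (cases "g a = g b")
    case True
    then have "g v = g a" using gmono[of a v] gmono[of v b] v ab by linarith
    then show ?thesis using v True by (intro exI[of _ v]) auto
  next
    case False
    then have lt: "g a < g b" using gmono[of a b] ab by linarith
    \<comment> \<open>If \<open>g\<close> grows between \<open>a\<close> and \<open>b\<close>, the
      tail from \<open>a\<close> attains its infimum before \<open>b\<close>, so that infimum is
      also the one over the interval.\<close>
    have "w \<le> b"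
    proof (rule ccontr)
      assume "\<not> w \<le> b"
      then have "I b \<le> I a" using I_le[of b w] w ab by simp
      then show False using lt unfolding g by auto
    qed
    then have mI: "m = I a"
      using m_le[of w] w I_le[of a v] v ab by fastforce
    \<comment> \<open>From the last time \<open>s\<close> in \<open>{v..b}\<close> with
      \<open>h s \<le> y\<close> on, \<open>h\<close> stays at least \<open>y\<close>, so the
      correction already has its final value \<open>g b\<close> there. The new infimum is attained
      at \<open>s\<close>.\<close>
    define y where "y = M + g b"
    have ya: "m \<le> y" using lt unfolding y_def mI g by auto
    have yb: "y \<le> I b" unfolding y_def g by auto
    define S where "S = {s\<in>{v..b}. h s \<le> y}"
    have "continuous_on {v..b} h" using h v ab by (auto intro: continuous_on_subset)
    then have "closed S"
      unfolding S_def by (intro continuous_on_closed_Collect_le continuous_intros) auto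
    moreover have "bounded S" by (rule bounded_subset[of "{v..b}"]) (auto simp: S_def)
    ultimately have "compact S" by (simp add: compact_eq_bounded_closed)
    moreover have "v \<in> S" using v ya by (simp add: S_def)
    ultimately obtain s where s: "s \<in> S" "\<forall>u\<in>S. u \<le> s"
      using compact_attains_sup[of S] by auto
    have s': "v \<le> s" "s \<le> b" "h s \<le> y" using s(1) by (auto simp: S_def)
    have after: "y \<le> h u" if u: "s \<le> u" "u \<le> 1" for u
    proof (cases "b \<le> u")
      case True
      then show ?thesis using yb I_le[of b u] u ab by simp
    next
      case ub: False
      show ?thesis
      proof (rule ccontr)
        assume lt: "\<not> y \<le> h u"
        have cub: "continuous_on {u..b} h" using h u v ab s' by (auto intro: continuous_on_subset)
        have "y \<le> h b" using yb I_le[of b b] ab by simp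
        then obtain z where z: "u \<le> z" "z \<le> b" "h z = y"
          using IVT'[of h u y b] cub lt ub by auto
        then have "z \<in> S" using s' u v by (simp add: S_def)
        then have "z = u" using s(2) z u by fastforce
        then show False using z lt by simp
      qed
    qed
    have "y \<le> I s"
      unfolding I_def using s' v ab by (intro cINF_greatest after) auto
    then have "g b \<le> g s" unfolding g y_def by auto
    moreover have "m - g a = M" using lt unfolding mI g by auto
    ultimately have "h s - 2 * g s \<le> m - g a - g b"
      using s'(3) unfolding y_def by linarith
    then show ?thesis using s' v by (intro exI[of _ s]) auto
  qed
  then obtain s where s: "s \<in> {a..b}" "h s - 2 * g s \<le> m - g a - g b" by auto
  have "(INF s\<in>{a..b}. h s - 2 * g s) \<le> h s - 2 * g s"
    using s(1) lower by (intro cINF_lower bdd_belowI2[of _ "m - g a - g b"]) auto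
  moreover have "m - g a - g b \<le> (INF s\<in>{a..b}. h s - 2 * g s)"
    using ab lower by (intro cINF_greatest) auto
  ultimately show ?thesis using s(2) unfolding g_def m_def by linarith
qed

text \<open>That is, \<open>cutoff h\<close> vanishes until \<open>h\<close> has attained its minimum. In this form it determines the
  correction from the past of \<open>h - 2 * cutoff h\<close>, as is needed for time reversal.\<close>

lemma cutoff_eq_past:
  fixes h :: "real \<Rightarrow> real"
  assumes h: "continuous_on {0..1} h" and t: "0 \<le> t" "t \<le> 1"
  shows "cutoff h t = max 0 (cutoff h t - ((INF s\<in>{0..t}. h s) - (INF s\<in>{0..1}. h s)))"
proof -
  note bdd = bdd_below_continuous_on_Icc[OF h]
  have M: "(INF s\<in>{0..1}. h s) \<le> (INF s\<in>{0..t}. h s)"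
    using t bdd by (intro cINF_superset_mono) auto
  obtain w where w: "0 \<le> w" "w \<le> 1" "h w = (INF s\<in>{0..1}. h s)"
    by (rule Icc_attains_inf[OF h, of 0 1]) auto
  show ?thesis
  proof (cases "w \<le> t")
    case True
    then have "(INF s\<in>{0..t}. h s) \<le> h w"
      using w t by (intro cINF_lower bdd_below_image_mono[OF bdd]) auto
    then show ?thesis using M w cutoff_nonneg[OF h t] by simp
  next
    case False
    then have "(INF s\<in>{t..1}. h s) \<le> h w" using inf_tail_le[OF h, of t w] w t by simp
    then have "cutoff h t = 0"
      using cutoff_nonneg[OF h t] w by (simp add: cutoff_def)
    then show ?thesis using M by simp
  qed
qed

subsection \<open>Chains of heights\<close>

definition cartan :: "('n \<Rightarrow> 'v::euclidean_space) \<Rightarrow> 'n \<Rightarrow> 'n \<Rightarrow> real"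
  where "cartan \<alpha> i j = \<alpha> i \<bullet> coroot (\<alpha> j)"

text \<open>The word \<open>a, b, a, \<dots>\<close> is indexed from \<open>1\<close>.\<close>

definition letter :: "'n \<Rightarrow> 'n \<Rightarrow> nat \<Rightarrow> 'n"
  where "letter a b k = (if odd k then a else b)"

lemma letter_simps [simp]:
  "letter a b 0 = b" "letter a b (Suc 0) = a" "letter a b (Suc (Suc k)) = letter a b k"
  by (simp_all add: letter_def)

text \<open>In a root system, consecutive values are the coordinates of the coroots obtained from
  the coroot of \<open>\<alpha> a\<close> by reflecting alternately in \<open>\<alpha> b\<close> and
  \<open>\<alpha> a\<close>.\<close>

fun chain_coeff :: "('n \<Rightarrow> 'v::euclidean_space) \<Rightarrow> 'n \<Rightarrow> 'n \<Rightarrow> nat \<Rightarrow> real"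
  where
    "chain_coeff \<alpha> a b 0 = 0"
  | "chain_coeff \<alpha> a b (Suc 0) = 1"
  | "chain_coeff \<alpha> a b (Suc (Suc k)) =
       - cartan \<alpha> (letter a b k) (letter a b (Suc k)) * chain_coeff \<alpha> a b (Suc k) - chain_coeff \<alpha> a b k"

text \<open>The infimum over \<open>s\<^sub>1 \<le> \<dots> \<le> s\<^sub>k \<le> t\<close>. Keeping
  the bound \<open>t\<close> variable makes it recursive, and the full chains as functions of
  \<open>t\<close> later recover the dominant path.\<close>

primrec chain_inf ::
  "('n \<Rightarrow> 'v::euclidean_space) \<Rightarrow> 'n \<Rightarrow> 'n \<Rightarrow> 'v lpath \<Rightarrow> nat \<Rightarrow> real \<Rightarrow> real"
  where
    "chain_inf \<alpha> a b \<eta> 0 t = 0"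
  | "chain_inf \<alpha> a b \<eta> (Suc k) t =
       (INF s\<in>{0..t}. chain_inf \<alpha> a b \<eta> k s
          + chain_coeff \<alpha> a b (Suc k) * path_height \<alpha> (letter a b (Suc k)) \<eta> s)"

lemma continuous_on_path_height:
  "continuous_on S \<eta> \<Longrightarrow> continuous_on S (path_height \<alpha> i \<eta>)"
  unfolding path_height_def by (intro continuous_intros)

lemma bdd_below_add_mult:
  fixes f h :: "real \<Rightarrow> real"
  assumes "bdd_below (f ` A)" "bdd_below (h ` A)" "0 \<le> d"
  shows "bdd_below ((\<lambda>s. f s + d * h s) ` A)"
proof -
  obtain x y where "\<And>s. s \<in> A \<Longrightarrow> x \<le> f s" "\<And>s. s \<in> A \<Longrightarrow> y \<le> h s"
    using assms(1,2) unfolding bdd_below_def by auto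
  then show ?thesis
    using assms(3) by (intro bdd_belowI2[of _ "x + d * y"]) (auto intro!: add_mono mult_left_mono)
qed

lemma bdd_below_running_inf:
  fixes f :: "real \<Rightarrow> real"
  assumes "bdd_below (f ` {0..1})"
  shows "bdd_below ((\<lambda>t. INF s\<in>{0..t}. f s) ` {0..1})"
proof -
  obtain x where x: "\<forall>s\<in>{0..1}. x \<le> f s"
    using assms unfolding bdd_below_def by auto
  show ?thesis
    by (rule bdd_belowI2[of _ x]) (use x in \<open>auto intro!: cINF_greatest\<close>)
qed

lemma bdd_below_chain_inf:
  assumes c: "continuous_on {0..1} \<eta>" and d: "\<And>r. r \<le> k \<Longrightarrow> 0 \<le> chain_coeff \<alpha> a b r"
  shows "bdd_below (chain_inf \<alpha> a b \<eta> k ` {0..1})"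
  using d
proof (induction k)
  case 0
  then show ?case by (auto intro: bdd_belowI2[of _ 0])
next
  case (Suc k)
  then have IH: "bdd_below (chain_inf \<alpha> a b \<eta> k ` {0..1})" by simp
  show ?case
    unfolding chain_inf.simps
    by (rule bdd_below_running_inf, rule bdd_below_add_mult[OF IH])
       (intro bdd_below_continuous_on_Icc continuous_on_path_height c Suc.prems order.refl)+
qed

text \<open>For a fixed inner time \<open>s\<close>, \<open>inf_minus_cutoff\<close> on
  \<open>{s..t}\<close> produces corrections at \<open>s\<close> and at \<open>t\<close>. The one at
  \<open>s\<close> cancels the term \<open>d * cutoff h s\<close>, and only the one at
  \<open>t\<close> remains. Both infima are exchanged to fix \<open>s\<close> first.\<close>

lemma running_inf_reflect:
  fixes F h g :: "real \<Rightarrow> real"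
  assumes h: "continuous_on {0..1} h" and F: "bdd_below (F ` {0..1})" and d: "0 \<le> d"
    and t: "t \<in> {0..1}"
  shows "(INF u\<in>{0..t}. (INF s\<in>{0..u}. F s + d * cutoff h s) + d * (h u - 2 * cutoff h u))
       = (INF u\<in>{0..t}. (INF s\<in>{0..u}. F s) + d * h u) - d * cutoff h t"
    (is "?L = ?R - _")
proof -
  let ?g = "cutoff h"
  have cg: "continuous_on {0..1} ?g" by (rule continuous_on_cutoff[OF h])
  have bh: "bdd_below (h ` {0..1})" and bg: "bdd_below (?g ` {0..1})"
    and bh': "bdd_below ((\<lambda>u. h u - 2 * ?g u) ` {0..1})"
    using h cg by (intro bdd_below_continuous_on_Icc continuous_intros; simp)+
  have bFg: "bdd_below ((\<lambda>s. F s + d * ?g s) ` {0..1})"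
    by (rule bdd_below_add_mult[OF F bg d])
  note mono = bdd_below_image_mono
  have swap: "(\<forall>u\<in>{0..t}. \<forall>s\<in>{0..u}. P s u) \<longleftrightarrow> (\<forall>s\<in>{0..t}. \<forall>u\<in>{s..t}. P s u)"
    for P :: "real \<Rightarrow> real \<Rightarrow> bool" by fastforce
  have L: "x \<le> ?L \<longleftrightarrow> (\<forall>s\<in>{0..t}. \<forall>u\<in>{s..t}. x - F s - d * ?g s \<le> d * (h u - 2 * ?g u))" for x
  proof -
    have "x \<le> ?L \<longleftrightarrow> (\<forall>u\<in>{0..t}. x - d * (h u - 2 * ?g u) \<le> (INF s\<in>{0..u}. F s + d * ?g s))"
      unfolding diff_le_eq using t
      by (intro le_cINF_iff mono[OF bdd_below_add_mult[OF bdd_below_running_inf[OF bFg] bh' d]]) auto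
    also have "\<dots> \<longleftrightarrow> (\<forall>u\<in>{0..t}. \<forall>s\<in>{0..u}. x - d * (h u - 2 * ?g u) \<le> F s + d * ?g s)"
      using t by (intro ball_cong refl le_cINF_iff mono[OF bFg]) auto
    also have "\<dots> \<longleftrightarrow> (\<forall>s\<in>{0..t}. \<forall>u\<in>{s..t}. x - d * (h u - 2 * ?g u) \<le> F s + d * ?g s)"
      by (rule swap)
    finally show ?thesis by (simp add: algebra_simps)
  qed
  have R: "x \<le> ?R \<longleftrightarrow> (\<forall>s\<in>{0..t}. \<forall>u\<in>{s..t}. x - F s \<le> d * h u)" for x
  proof -
    have "x \<le> ?R \<longleftrightarrow> (\<forall>u\<in>{0..t}. x - d * h u \<le> (INF s\<in>{0..u}. F s))"
      unfolding diff_le_eq using t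
      by (intro le_cINF_iff mono[OF bdd_below_add_mult[OF bdd_below_running_inf[OF F] bh d]]) auto
    also have "\<dots> \<longleftrightarrow> (\<forall>u\<in>{0..t}. \<forall>s\<in>{0..u}. x - d * h u \<le> F s)"
      using t by (intro ball_cong refl le_cINF_iff mono[OF F]) auto
    also have "\<dots> \<longleftrightarrow> (\<forall>s\<in>{0..t}. \<forall>u\<in>{s..t}. x - d * h u \<le> F s)"
      by (rule swap)
    finally show ?thesis by (simp add: algebra_simps)
  qed
  have "x \<le> ?L \<longleftrightarrow> x \<le> ?R - d * ?g t" for x
  proof -
    have "x \<le> ?L \<longleftrightarrow> (\<forall>s\<in>{0..t}. x - F s - d * ?g s \<le> d * (INF u\<in>{s..t}. h u - 2 * ?g u))"
      unfolding L using t d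
      by (intro ball_cong refl le_mult_cINF_iff[symmetric] mono[OF bh']) auto
    also have "\<dots> \<longleftrightarrow> (\<forall>s\<in>{0..t}. x + d * ?g t - F s \<le> d * (INF u\<in>{s..t}. h u))"
      using t by (intro ball_cong refl, subst inf_minus_cutoff[OF h]) (auto simp: algebra_simps)
    also have "\<dots> \<longleftrightarrow> (\<forall>s\<in>{0..t}. \<forall>u\<in>{s..t}. x + d * ?g t - F s \<le> d * h u)"
      using t d by (intro ball_cong refl le_mult_cINF_iff mono[OF bh]) auto
    also have "\<dots> \<longleftrightarrow> x \<le> ?R - d * ?g t"
      unfolding R[symmetric] by linarith
    finally show ?thesis .
  qed
  then show ?thesis by (meson order.eq_iff order.refl)
qed

text \<open>Multiplied by \<open>d\<close>, the cutoff is the minimum of \<open>d\<close> and a tail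
  infimum of \<open>d * h\<close> up to a constant. The tail infimum joins the infimum of
  \<open>F\<close> as one more nested variable, so a corrected chain becomes a minimum involving
  chains of the same length and of the next length.\<close>

lemma running_inf_cutoff:
  fixes F h :: "real \<Rightarrow> real"
  assumes h: "continuous_on {0..1} h" and F: "bdd_below (F ` {0..1})" and d: "0 \<le> d"
  shows "(INF s\<in>{0..1}. F s + d * cutoff h s)
       = min ((INF s\<in>{0..1}. F s) + d)
           ((INF u\<in>{0..1}. (INF s\<in>{0..u}. F s) + d * h u) - d * (INF s\<in>{0..1}. h s))"
    (is "?L = min (?A + d) (?B - d * ?M)")
proof -
  note bh = bdd_below_continuous_on_Icc[OF h]
  note mono = bdd_below_image_mono
  have bg: "bdd_below (cutoff h ` {0..1})"
    by (intro bdd_below_continuous_on_Icc continuous_on_cutoff h)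
  have 1: "x \<le> ?B - d * ?M \<longleftrightarrow> (\<forall>s\<in>{0..1}. x + d * ?M - F s \<le> d * (INF u\<in>{s..1}. h u))" for x
  proof -
    have "x \<le> ?B - d * ?M \<longleftrightarrow> x + d * ?M \<le> ?B" by linarith
    also have "\<dots> \<longleftrightarrow> (\<forall>u\<in>{0..1}. x + d * ?M - d * h u \<le> (INF s\<in>{0..u}. F s))"
      unfolding diff_le_eq
      by (intro le_cINF_iff bdd_below_add_mult[OF bdd_below_running_inf[OF F] bh d]) auto
    also have "\<dots> \<longleftrightarrow> (\<forall>u\<in>{0..1}. \<forall>s\<in>{0..u}. x + d * ?M - d * h u \<le> F s)"
      by (intro ball_cong refl le_cINF_iff mono[OF F]) auto
    also have "\<dots> \<longleftrightarrow> (\<forall>s\<in>{0..1}. \<forall>u\<in>{s..1}. x + d * ?M - F s \<le> d * h u)"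
      by (fastforce simp: algebra_simps)
    also have "\<dots> \<longleftrightarrow> (\<forall>s\<in>{0..1}. x + d * ?M - F s \<le> d * (INF u\<in>{s..1}. h u))"
      using d by (intro ball_cong refl le_mult_cINF_iff[symmetric] mono[OF bh]) auto
    finally show ?thesis .
  qed
  have 2: "x \<le> ?A + d \<longleftrightarrow> (\<forall>s\<in>{0..1}. x \<le> F s + d)" for x
  proof -
    have "x \<le> ?A + d \<longleftrightarrow> x - d \<le> ?A" by linarith
    also have "\<dots> \<longleftrightarrow> (\<forall>s\<in>{0..1}. x - d \<le> F s)" using F by (intro le_cINF_iff) auto
    finally show ?thesis by (simp add: algebra_simps)
  qed
  have 3: "x \<le> ?L \<longleftrightarrow> (\<forall>s\<in>{0..1}. x \<le> F s + d * cutoff h s)" for x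
    by (intro le_cINF_iff bdd_below_add_mult F bg d) auto
  have 4: "x \<le> F s + d * cutoff h s \<longleftrightarrow>
      x \<le> F s + d \<and> x + d * ?M - F s \<le> d * (INF u\<in>{s..1}. h u)" for x s
  proof -
    have "d * cutoff h s = min d (d * (INF u\<in>{s..1}. h u) - d * ?M)"
      using d by (simp add: cutoff_def min_mult_distrib_left right_diff_distrib)
    then show ?thesis by linarith
  qed
  have "x \<le> ?L \<longleftrightarrow> x \<le> min (?A + d) (?B - d * ?M)" for x
    unfolding min.bounded_iff 1 2 3 4 by blast
  then show ?thesis by (meson order.eq_iff order.refl)
qed

text \<open>The recursion defining the coefficients is exactly what makes the contributions of an inner
  variable cancel; only a last variable that does not belong to \<open>i\<close> leaves a remainder.\<close>

lemma chain_inf_reflect: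
  assumes c: "continuous_on {0..1} \<eta>" and c': "continuous_on {0..1} \<eta>'"
    and \<eta>': "\<And>t. t \<in> {0..1} \<Longrightarrow> \<eta>' t = \<eta> t - cutoff (path_height \<alpha> i \<eta>) t *\<^sub>R \<alpha> i"
    and ii: "cartan \<alpha> i i = 2"
    and ab: "a \<noteq> b" "i = a \<or> i = b"
    and d: "\<And>r. r \<le> k \<Longrightarrow> 0 \<le> chain_coeff \<alpha> a b r"
    and t: "t \<in> {0..1}"
  shows "letter a b k = i \<Longrightarrow> chain_inf \<alpha> a b \<eta>' k t
           = chain_inf \<alpha> a b \<eta> k t - chain_coeff \<alpha> a b k * cutoff (path_height \<alpha> i \<eta>) t"
    and "letter a b k \<noteq> i \<Longrightarrow> k = Suc r \<Longrightarrow> chain_inf \<alpha> a b \<eta>' k t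
           = (INF s\<in>{0..t}. (chain_inf \<alpha> a b \<eta> r s + chain_coeff \<alpha> a b k * path_height \<alpha> (letter a b k) \<eta> s)
                + chain_coeff \<alpha> a b (Suc k) * cutoff (path_height \<alpha> i \<eta>) s)"
proof -
  define h where "h = path_height \<alpha> i \<eta>"
  define g where "g = cutoff h"
  have h: "continuous_on {0..1} h" unfolding h_def by (rule continuous_on_path_height[OF c])
  have height: "path_height \<alpha> l \<eta>' s = path_height \<alpha> l \<eta> s - cartan \<alpha> i l * g s" if "s \<in> {0..1}" for l s
    unfolding path_height_def \<eta>'[OF that] cartan_def g_def h_def by (simp add: inner_diff_left)
  have heighti: "path_height \<alpha> i \<eta>' s = h s - 2 * g s" if "s \<in> {0..1}" for s
    using height[OF that, of i] ii by (simp add: h_def)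
  have other: "chain_inf \<alpha> a b \<eta>' (Suc r) t
       = (INF s\<in>{0..t}. (chain_inf \<alpha> a b \<eta> r s + chain_coeff \<alpha> a b (Suc r) * path_height \<alpha> (letter a b (Suc r)) \<eta> s)
                + chain_coeff \<alpha> a b (Suc (Suc r)) * g s)"
    if IH: "\<And>t. t \<in> {0..1} \<Longrightarrow> chain_inf \<alpha> a b \<eta>' r t = chain_inf \<alpha> a b \<eta> r t - chain_coeff \<alpha> a b r * g t"
      and r: "letter a b r = i" and t: "t \<in> {0..1}" for r t
    unfolding chain_inf.simps
  proof (intro INF_cong refl)
    fix s assume "s \<in> {0..t}"
    then have s: "s \<in> {0..1}" using t by auto
    show "chain_inf \<alpha> a b \<eta>' r s + chain_coeff \<alpha> a b (Suc r) * path_height \<alpha> (letter a b (Suc r)) \<eta>' s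
       = (chain_inf \<alpha> a b \<eta> r s + chain_coeff \<alpha> a b (Suc r) * path_height \<alpha> (letter a b (Suc r)) \<eta> s)
                + chain_coeff \<alpha> a b (Suc (Suc r)) * g s"
      unfolding IH[OF s] height[OF s] chain_coeff.simps r by (simp add: algebra_simps)
  qed
  \<comment> \<open>Occurrences of the letter \<open>i\<close> are two positions apart; the
    induction passes over the position between them by \<open>other\<close>.\<close>
  have same: "letter a b k = i \<longrightarrow> (\<forall>t\<in>{0..1}. chain_inf \<alpha> a b \<eta>' k t
           = chain_inf \<alpha> a b \<eta> k t - chain_coeff \<alpha> a b k * g t)"
    if "\<And>r. r \<le> k \<Longrightarrow> 0 \<le> chain_coeff \<alpha> a b r" for k
    using that
  proof (induction k rule: less_induct)
    case (less k)
    consider "k = 0" | "k = Suc 0" | r where "k = Suc (Suc r)"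
      by (metis not0_implies_Suc)
    then show ?case
    proof cases
      case 1
      then show ?thesis by simp
    next
      case 2
      show ?thesis
      proof (intro impI ballI)
        fix t :: real assume "letter a b k = i" and t: "t \<in> {0..1}"
        then have i: "a = i" using 2 by simp
        have "(INF s\<in>{0..t}. path_height \<alpha> i \<eta>' s) = (INF s\<in>{0..t}. h s - 2 * g s)"
          using t by (intro INF_cong refl heighti) auto
        also have "\<dots> = (INF s\<in>{0..t}. h s) - g t"
          using inf_minus_cutoff[OF h, of 0 t] t by (simp add: g_def)
        finally show "chain_inf \<alpha> a b \<eta>' k t = chain_inf \<alpha> a b \<eta> k t - chain_coeff \<alpha> a b k * g t"
          using 2 i by (simp add: h_def)
      qed
    next
      case 3
      show ?thesis
      proof (intro impI ballI)
        fix t :: real assume k: "letter a b k = i" and t: "t \<in> {0..1}"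
        then have r: "letter a b r = i" using 3 by simp
        let ?d = "chain_coeff \<alpha> a b k"
        define F where "F s = chain_inf \<alpha> a b \<eta> r s + chain_coeff \<alpha> a b (Suc r) * path_height \<alpha> (letter a b (Suc r)) \<eta> s" for s
        have IH: "chain_inf \<alpha> a b \<eta>' r t = chain_inf \<alpha> a b \<eta> r t - chain_coeff \<alpha> a b r * g t"
          if "t \<in> {0..1}" for t
          using less.IH[of r] less.prems r 3 that by simp
        have bF: "bdd_below (F ` {0..1})"
          unfolding F_def using less.prems 3
          by (intro bdd_below_add_mult bdd_below_chain_inf bdd_below_continuous_on_Icc
                continuous_on_path_height c) auto
        have "chain_inf \<alpha> a b \<eta>' k t =
            (INF u\<in>{0..t}. (INF s\<in>{0..u}. F s + ?d * g s) + ?d * (h u - 2 * g u))"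
          unfolding 3 chain_inf.simps(2)[where k = "Suc r"]
        proof (intro INF_cong refl)
          fix u assume "u \<in> {0..t}"
          then have u: "u \<in> {0..1}" using t by auto
          have l: "letter a b (Suc (Suc r)) = i" using r by simp
          show "chain_inf \<alpha> a b \<eta>' (Suc r) u + chain_coeff \<alpha> a b (Suc (Suc r)) * path_height \<alpha> (letter a b (Suc (Suc r))) \<eta>' u
              = (INF s\<in>{0..u}. F s + chain_coeff \<alpha> a b (Suc (Suc r)) * g s) + chain_coeff \<alpha> a b (Suc (Suc r)) * (h u - 2 * g u)"
            unfolding l heighti[OF u] F_def
            by (subst other[OF _ r u]) (auto simp: IH)
        qed
        also have "\<dots> = (INF u\<in>{0..t}. (INF s\<in>{0..u}. F s) + ?d * h u) - ?d * g t"
          unfolding g_def using less.prems by (intro running_inf_reflect h bF t) auto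
        also have "(INF u\<in>{0..t}. (INF s\<in>{0..u}. F s) + ?d * h u) = chain_inf \<alpha> a b \<eta> k t"
          using r by (simp add: 3 F_def h_def del: chain_coeff.simps)
        finally show "chain_inf \<alpha> a b \<eta>' k t = chain_inf \<alpha> a b \<eta> k t - ?d * g t" .
      qed
    qed
  qed
  show "letter a b k = i \<Longrightarrow> chain_inf \<alpha> a b \<eta>' k t
           = chain_inf \<alpha> a b \<eta> k t - chain_coeff \<alpha> a b k * cutoff (path_height \<alpha> i \<eta>) t"
    using same[of k] d t by (simp add: g_def h_def)
  assume k: "letter a b k \<noteq> i" "k = Suc r"
  then have r: "letter a b r = i" using ab by (auto simp: letter_def split: if_splits)
  have "chain_inf \<alpha> a b \<eta>' r t = chain_inf \<alpha> a b \<eta> r t - chain_coeff \<alpha> a b r * g t"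
    if "t \<in> {0..1}" for t
    using same[of r] d k r that by simp
  note other[OF this r t]
  then show "chain_inf \<alpha> a b \<eta>' k t
           = (INF s\<in>{0..t}. (chain_inf \<alpha> a b \<eta> r s + chain_coeff \<alpha> a b k * path_height \<alpha> (letter a b k) \<eta> s)
                + chain_coeff \<alpha> a b (Suc k) * cutoff (path_height \<alpha> i \<eta>) s)"
    unfolding k(2) g_def h_def .
qed

subsection \<open>Root operators and time reversal\<close>

text \<open>Integrality is asked of the endpoint only. Integrality of the minima is the point at
  issue and stays a separate hypothesis.\<close>

definition integral_path :: "('n \<Rightarrow> 'v::euclidean_space) \<Rightarrow> 'v lpath \<Rightarrow> bool"
  where "integral_path \<alpha> \<eta> \<longleftrightarrow> \<eta> \<in> extensional {0..1} \<and> continuous_on {0..1} \<eta> \<and> \<eta> 0 = 0 \<and>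
    (\<forall>i. path_height \<alpha> i \<eta> 1 \<in> \<int>)"

text \<open>Littelmann's dual path, translated to start at 0. It turns infima over the past into
  infima over the future.\<close>

definition rev_path :: "'v::euclidean_space lpath \<Rightarrow> 'v lpath"
  where "rev_path \<eta> = (\<lambda>t\<in>{0..1}. \<eta> (1 - t) - \<eta> 1)"

lemma integral_path_height:
  assumes "integral_path \<alpha> \<eta>"
  shows "continuous_on {0..1} (path_height \<alpha> i \<eta>)" "path_height \<alpha> i \<eta> 0 = 0"
    "path_height \<alpha> i \<eta> 1 \<in> \<int>"
proof -
  show "continuous_on {0..1} (path_height \<alpha> i \<eta>)"
    using assms by (intro continuous_on_path_height) (simp add: integral_path_def)
qed (use assms in \<open>simp_all add: integral_path_def path_height_def\<close>)

lemma min_height_le: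
  assumes "integral_path \<alpha> \<eta>" "t \<in> {0..1}"
  shows "min_height \<alpha> 1 i \<eta> \<le> path_height \<alpha> i \<eta> t"
  unfolding min_height_def using assms
  by (intro cINF_lower bdd_below_continuous_on_Icc integral_path_height)

lemma min_height_nonpos:
  "integral_path \<alpha> \<eta> \<Longrightarrow> min_height \<alpha> 1 i \<eta> \<le> 0"
  using min_height_le[of \<alpha> \<eta> 0 i] integral_path_height(2)[of \<alpha> \<eta> i] by simp

lemma rev_path_rev_path:
  assumes "integral_path \<alpha> \<eta>"
  shows "rev_path (rev_path \<eta>) = \<eta>"
  using assms
  by (auto simp: integral_path_def rev_path_def fun_eq_iff extensional_def)

lemma path_height_rev_path:
  "t \<in> {0..1} \<Longrightarrow> path_height \<alpha> i (rev_path \<eta>) t = path_height \<alpha> i \<eta> (1 - t) - path_height \<alpha> i \<eta> 1"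
  by (simp add: path_height_def rev_path_def inner_diff_left)

lemma integral_path_rev_path:
  assumes "integral_path \<alpha> \<eta>"
  shows "integral_path \<alpha> (rev_path \<eta>)"
proof -
  have "continuous_on {0..1} \<eta>" using assms by (simp add: integral_path_def)
  moreover have "continuous_on {0..1} (\<lambda>t. 1 - t :: real)" by (intro continuous_intros)
  ultimately have "continuous_on {0..1} (\<lambda>t. \<eta> (1 - t))"
    by (rule continuous_on_compose2) auto
  then have "continuous_on {0..1} (\<lambda>t. \<eta> (1 - t) - \<eta> 1)"
    by (intro continuous_on_diff continuous_on_const)
  then have "continuous_on {0..1} (rev_path \<eta>)"
    by (rule continuous_on_eq) (simp add: rev_path_def)
  then show ?thesis
    using assms by (auto simp: integral_path_def path_height_rev_path, auto simp: rev_path_def path_height_def)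
qed

lemma INF_path_height_rev_path:
  assumes \<eta>: "integral_path \<alpha> \<eta>" and ab: "0 \<le> a" "a \<le> b" "b \<le> 1"
  shows "(INF s\<in>{a..b}. path_height \<alpha> i (rev_path \<eta>) s)
       = (INF s\<in>{1-b..1-a}. path_height \<alpha> i \<eta> s) - path_height \<alpha> i \<eta> 1" (is "?L = ?R - ?c")
proof -
  note bdd = bdd_below_continuous_on_Icc[OF integral_path_height(1)]
  have "x \<le> ?L \<longleftrightarrow> x \<le> ?R - ?c" for x
  proof -
    have "x \<le> ?L \<longleftrightarrow> (\<forall>s\<in>{a..b}. x \<le> path_height \<alpha> i (rev_path \<eta>) s)"
      using ab by (intro le_cINF_iff bdd_below_image_mono[OF bdd[OF integral_path_rev_path[OF \<eta>]]]) auto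
    also have "\<dots> \<longleftrightarrow> (\<forall>s\<in>{a..b}. x + ?c \<le> path_height \<alpha> i \<eta> (1 - s))"
      using ab by (intro ball_cong refl, subst path_height_rev_path) auto
    also have "\<dots> \<longleftrightarrow> (\<forall>s\<in>(\<lambda>s. 1 - s) ` {a..b}. x + ?c \<le> path_height \<alpha> i \<eta> s)"
      by blast
    also have "(\<lambda>s. 1 - s) ` {a..b} = {1-b..1-a}" by simp
    also have "(\<forall>s\<in>{1-b..1-a}. x + ?c \<le> path_height \<alpha> i \<eta> s) \<longleftrightarrow> x + ?c \<le> ?R"
      using ab by (intro le_cINF_iff[symmetric] bdd_below_image_mono[OF bdd[OF \<eta>]]) auto
    finally show ?thesis by linarith
  qed
  then show ?thesis by (meson order.eq_iff order.refl)
qed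

lemma min_height_rev_path:
  assumes "integral_path \<alpha> \<eta>"
  shows "min_height \<alpha> 1 i (rev_path \<eta>) = min_height \<alpha> 1 i \<eta> - path_height \<alpha> i \<eta> 1"
  using INF_path_height_rev_path[OF assms, of 0 1] by (simp add: min_height_def)

locale cartan_roots =
  fixes \<alpha> :: "'n::finite \<Rightarrow> 'v::euclidean_space"
  assumes cartan_Ints: "cartan \<alpha> k l \<in> \<int>"
    and cartan_diag: "cartan \<alpha> l l = 2"
begin

text \<open>The final height exceeds the minimum by a positive integer, so the cutoff reaches 1 at
  the end and the endpoint moves by exactly \<open>\<alpha> l\<close>. The new minimum is
  \<open>inf_minus_cutoff\<close> on the whole interval.\<close>

lemma root_f_SomeD:
  assumes \<eta>: "integral_path \<alpha> \<eta>" and M: "min_height \<alpha> 1 l \<eta> \<in> \<int>"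
    and f: "root_f \<alpha> 1 l \<eta> = Some \<eta>'"
  shows "t \<in> {0..1} \<Longrightarrow> \<eta>' t = \<eta> t - cutoff (path_height \<alpha> l \<eta>) t *\<^sub>R \<alpha> l"
    and "cutoff (path_height \<alpha> l \<eta>) 1 = 1"
    and "integral_path \<alpha> \<eta>'"
    and "min_height \<alpha> 1 l \<eta>' = min_height \<alpha> 1 l \<eta> - 1"
proof -
  let ?h = "path_height \<alpha> l \<eta>"
  note h = integral_path_height[OF \<eta>, of l]
  have ne: "?h 1 \<noteq> min_height \<alpha> 1 l \<eta>" 
    and \<eta>': "\<eta>' = (\<lambda>t\<in>{0..1}. \<eta> t - cutoff ?h t *\<^sub>R \<alpha> l)"
    using f by (auto simp: root_f_def cutoff_def min_height_def split: if_splits)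
  show eq: "\<eta>' t = \<eta> t - cutoff ?h t *\<^sub>R \<alpha> l" if "t \<in> {0..1}" for t
    using that by (simp add: \<eta>')
  have "0 < ?h 1 - min_height \<alpha> 1 l \<eta>" using ne min_height_le[OF \<eta>, of 1 l] by simp
  moreover have "?h 1 - min_height \<alpha> 1 l \<eta> \<in> \<int>" using M h(3) by simp
  ultimately have "1 \<le> ?h 1 - min_height \<alpha> 1 l \<eta>"
    by (metis Ints_nonzero_abs_ge1 abs_of_pos less_irrefl)
  then show g1: "cutoff ?h 1 = 1" by (simp add: cutoff_def min_height_def)
  have height: "path_height \<alpha> k \<eta>' t = path_height \<alpha> k \<eta> t - cartan \<alpha> l k * cutoff ?h t"
    if "t \<in> {0..1}" for k t
    unfolding path_height_def eq[OF that] cartan_def by (simp add: inner_diff_left)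
  have "continuous_on {0..1} (\<lambda>t. \<eta> t - cutoff ?h t *\<^sub>R \<alpha> l)"
    using \<eta> h(1) by (intro continuous_intros continuous_on_cutoff) (simp_all add: integral_path_def)
  then have "continuous_on {0..1} \<eta>'"
    by (rule continuous_on_eq) (simp add: eq)
  moreover have "path_height \<alpha> k \<eta>' 1 \<in> \<int>" for k
    using height[of 1 k] g1 integral_path_height(3)[OF \<eta>, of k] cartan_Ints[of l k] by simp
  ultimately show "integral_path \<alpha> \<eta>'"
    using \<eta> eq[of 0] unfolding integral_path_def by (simp add: \<eta>')
  have "min_height \<alpha> 1 l \<eta>' = (INF s\<in>{0..1}. ?h s - 2 * cutoff ?h s)"
    unfolding min_height_def by (intro INF_cong refl) (simp add: height cartan_diag)
  then show "min_height \<alpha> 1 l \<eta>' = min_height \<alpha> 1 l \<eta> - 1"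
    using inf_minus_cutoff[OF h(1), of 0 1] g1 by (simp add: min_height_def)
qed

text \<open>Reversal makes \<open>root_f\<close> its own inverse: on the reversed image it subtracts
  \<open>1 - cutoff\<close> at the mirrored time, which together with the shift of the endpoint by
  \<open>\<alpha> l\<close> undoes the first application.\<close>

lemma root_f_rev_path:
  assumes \<eta>: "integral_path \<alpha> \<eta>" and M: "min_height \<alpha> 1 l \<eta> \<in> \<int>"
    and f: "root_f \<alpha> 1 l \<eta> = Some \<eta>'"
  shows "root_f \<alpha> 1 l (rev_path \<eta>') = Some (rev_path \<eta>)"
proof -
  let ?h = "path_height \<alpha> l \<eta>"
  note h = integral_path_height[OF \<eta>, of l]
  note D = root_f_SomeD[OF \<eta> M f]
  have "min_height \<alpha> 1 l \<eta>' \<noteq> 0" using D(4) min_height_nonpos[OF \<eta>, of l] by simp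
  then have "path_height \<alpha> l (rev_path \<eta>') 1 \<noteq> min_height \<alpha> 1 l (rev_path \<eta>')"
    using min_height_rev_path[OF D(3), of l] path_height_rev_path[of 1 \<alpha> l \<eta>']
      integral_path_height(2)[OF D(3), of l] by simp
  moreover have "rev_path \<eta>' t - min 1 ((INF s\<in>{t..1}. path_height \<alpha> l (rev_path \<eta>') s)
      - min_height \<alpha> 1 l (rev_path \<eta>')) *\<^sub>R \<alpha> l = rev_path \<eta> t" if t: "t \<in> {0..1}" for t
  proof -
    let ?g = "cutoff ?h (1 - t)"
    have "(INF s\<in>{0..1-t}. path_height \<alpha> l \<eta>' s) = (INF s\<in>{0..1-t}. ?h s - 2 * cutoff ?h s)"
      using t by (intro INF_cong refl) 
        (simp add: path_height_def D(1) inner_diff_left cartan_diag[unfolded cartan_def])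
    also have "\<dots> = (INF s\<in>{0..1-t}. ?h s) - ?g"
      using inf_minus_cutoff[OF h(1), of 0 "1 - t"] t by simp
    finally have "(INF s\<in>{t..1}. path_height \<alpha> l (rev_path \<eta>') s) - min_height \<alpha> 1 l (rev_path \<eta>')
        = (INF s\<in>{0..1-t}. ?h s) - ?g - (min_height \<alpha> 1 l \<eta> - 1)"
      using t by (simp add: INF_path_height_rev_path[OF D(3)] min_height_rev_path[OF D(3)] D(4))
    \<comment> \<open>With \<open>A\<close> the past infimum, \<open>g\<close> the cutoff and
      \<open>M\<close> the minimum, \<open>min 1 (A - g - M + 1)\<close> is
      \<open>1 - max 0 (g - (A - M))\<close>, and \<open>cutoff_eq_past\<close> evaluates the
      maximum to \<open>g\<close>.\<close>
    then have min1: "min 1 ((INF s\<in>{t..1}. path_height \<alpha> l (rev_path \<eta>') s) - min_height \<alpha> 1 l (rev_path \<eta>')) = 1 - ?g"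
      using cutoff_eq_past[OF h(1), of "1 - t"] t unfolding min_height_def by auto
    have ends: "\<eta>' (1 - t) = \<eta> (1 - t) - ?g *\<^sub>R \<alpha> l" "\<eta>' 1 = \<eta> 1 - \<alpha> l"
      using D(1)[of "1 - t"] D(1)[of 1] D(2) t by simp_all
    have rev: "rev_path \<eta>' t = \<eta>' (1 - t) - \<eta>' 1" "rev_path \<eta> t = \<eta> (1 - t) - \<eta> 1"
      using t by (simp_all add: rev_path_def)
    show ?thesis unfolding min1 rev ends by (simp add: algebra_simps)
  qed
  ultimately show ?thesis
    by (auto simp: root_f_def rev_path_def fun_eq_iff)
qed

end

text \<open>The number of steps is recorded because the integrality proof is an induction on it; the
  set \<open>S\<close> allows confinement to a rank two subsystem.\<close>

inductive reach :: "('n \<Rightarrow> 'v::euclidean_space) \<Rightarrow> 'n set \<Rightarrow> 'v lpath \<Rightarrow> nat \<Rightarrow> 'v lpath \<Rightarrow> bool"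
  for \<alpha> S \<pi>
  where
    start: "reach \<alpha> S \<pi> 0 \<pi>"
  | step: "reach \<alpha> S \<pi> n \<eta> \<Longrightarrow> l \<in> S \<Longrightarrow> root_f \<alpha> 1 l \<eta> = Some \<eta>' \<Longrightarrow> reach \<alpha> S \<pi> (Suc n) \<eta>'"

lemma reach_trans:
  assumes "reach \<alpha> T \<pi> q \<pi>'" "reach \<alpha> S \<pi>' n \<eta>" "S \<subseteq> T"
  shows "reach \<alpha> T \<pi> (q + n) \<eta>"
  using assms(2,1,3) by induction (auto intro: reach.intros)

subsection \<open>Rank two\<close>

text \<open>In the applications \<open>m\<close> is the order of the product of the two simple reflections.\<close>

definition closing :: "('n \<Rightarrow> 'v::euclidean_space) \<Rightarrow> nat \<Rightarrow> 'n \<Rightarrow> 'n \<Rightarrow> bool"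
  where "closing \<alpha> m a b \<longleftrightarrow> (\<forall>k\<le>m. 0 \<le> chain_coeff \<alpha> a b k) \<and>
    chain_coeff \<alpha> a b (m - 1) = 1 \<and> chain_coeff \<alpha> a b m = 0"

text \<open>Makes the depth, a nonnegative real not yet known to be an integer, a measure for
  well-founded induction.\<close>

lemma nat_floor_less_add_1: "0 \<le> x \<Longrightarrow> nat \<lfloor>x\<rfloor> < nat \<lfloor>x + 1 :: real\<rfloor>"
  by (simp add: nat_add_distrib)

locale rank_two = cartan_roots \<alpha> for \<alpha> :: "'n::finite \<Rightarrow> 'v::euclidean_space" +
  fixes i j :: 'n and m :: nat
  assumes neq: "i \<noteq> j" and m: "2 \<le> m" and closing: "closing \<alpha> m i j" "closing \<alpha> m j i"
begin

definition orders :: "('n \<times> 'n) set"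
  where "orders = {(i, j), (j, i)}"

definition chain_integral :: "'v lpath \<Rightarrow> bool"
  where "chain_integral \<eta> \<longleftrightarrow> (\<forall>(a, b)\<in>orders. \<forall>k<m. chain_inf \<alpha> a b \<eta> k 1 \<in> \<int>)"

text \<open>It vanishes on paths dominant for \<open>i\<close> and \<open>j\<close> and rises by 1
  with each of their operators, so it counts the steps from the dominant path.\<close>

definition depth :: "'v lpath \<Rightarrow> real"
  where "depth \<eta> = - chain_inf \<alpha> i j \<eta> (m - 1) 1 - chain_inf \<alpha> j i \<eta> (m - 1) 1"

text \<open>The two full chains end in different letters.\<close>

definition dominant_part :: "'v lpath \<Rightarrow> 'v lpath"
  where "dominant_part \<eta> = (\<lambda>t\<in>{0..1}. \<eta> t
    - chain_inf \<alpha> i j \<eta> (m - 1) t *\<^sub>R \<alpha> (letter i j (m - 1))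
    - chain_inf \<alpha> j i \<eta> (m - 1) t *\<^sub>R \<alpha> (letter j i (m - 1)))"

lemma chain_coeff_Ints: "chain_coeff \<alpha> a b k \<in> \<int>"
  by (induction k rule: induct_nat_012) (simp_all add: cartan_Ints)

lemma ordersD:
  assumes "(a, b) \<in> orders"
  shows "a \<noteq> b" "l \<in> {i, j} \<Longrightarrow> l = a \<or> l = b" "k \<le> m \<Longrightarrow> 0 \<le> chain_coeff \<alpha> a b k"
    "chain_coeff \<alpha> a b (m - 1) = 1" "chain_coeff \<alpha> a b m = 0" "letter a b k \<in> {i, j}"
  using assms neq closing by (auto simp: orders_def closing_def letter_def)

text \<open>Choosing all times equal to 0 contributes the value 0.\<close>

lemma chain_inf_nonpos:
  assumes \<eta>: "integral_path \<alpha> \<eta>" and ab: "(a, b) \<in> orders" and t: "t \<in> {0..1}"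
  shows "k \<le> m \<Longrightarrow> chain_inf \<alpha> a b \<eta> k t \<le> 0"
  using t
proof (induction k arbitrary: t)
  case (Suc k)
  have c: "continuous_on {0..1} \<eta>" using \<eta> by (simp add: integral_path_def)
  have "bdd_below ((\<lambda>s. chain_inf \<alpha> a b \<eta> k s + chain_coeff \<alpha> a b (Suc k) * path_height \<alpha> (letter a b (Suc k)) \<eta> s) ` {0..t})"
    using Suc.prems
    by (intro bdd_below_image_mono[OF bdd_below_add_mult[OF bdd_below_chain_inf[OF c] bdd_below_continuous_on_Icc]]
        continuous_on_path_height c ordersD[OF ab]) auto
  then have "chain_inf \<alpha> a b \<eta> (Suc k) t \<le> chain_inf \<alpha> a b \<eta> k 0
      + chain_coeff \<alpha> a b (Suc k) * path_height \<alpha> (letter a b (Suc k)) \<eta> 0"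
    unfolding chain_inf.simps using Suc.prems by (intro cINF_lower) auto
  also have "\<dots> \<le> 0" using Suc by (simp add: integral_path_height(2)[OF \<eta>])
  finally show ?case .
qed simp

lemma depth_nonneg: "integral_path \<alpha> \<eta> \<Longrightarrow> 0 \<le> depth \<eta>"
  using chain_inf_nonpos[of \<eta> i j 1 "m - 1"] chain_inf_nonpos[of \<eta> j i 1 "m - 1"]
  by (simp add: depth_def orders_def)

lemma chain_inf_dominant:
  assumes \<eta>: "integral_path \<alpha> \<eta>" and dom: "\<And>l. l \<in> {i, j} \<Longrightarrow> min_height \<alpha> 1 l \<eta> = 0"
    and ab: "(a, b) \<in> orders" and t: "t \<in> {0..1}"
  shows "k \<le> m \<Longrightarrow> chain_inf \<alpha> a b \<eta> k t = 0"
  using t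
proof (induction k arbitrary: t)
  case (Suc k)
  have "0 \<le> chain_inf \<alpha> a b \<eta> (Suc k) t"
    unfolding chain_inf.simps
  proof (rule cINF_greatest)
    fix s assume "s \<in> {0..t}"
    then have s: "s \<in> {0..1}" using Suc.prems by auto
    have "0 \<le> path_height \<alpha> (letter a b (Suc k)) \<eta> s"
      using min_height_le[OF \<eta> s, of "letter a b (Suc k)"] dom[OF ordersD(6)[OF ab]] by simp
    then show "0 \<le> chain_inf \<alpha> a b \<eta> k s + chain_coeff \<alpha> a b (Suc k) * path_height \<alpha> (letter a b (Suc k)) \<eta> s"
      using Suc s ordersD(3)[OF ab Suc.prems(1)] by simp
  qed (use Suc.prems in auto)
  then show ?case using chain_inf_nonpos[OF \<eta> ab Suc.prems(2,1)] by simp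
qed simp

lemma dominant:
  assumes \<eta>: "integral_path \<alpha> \<eta>" and dom: "\<And>l. l \<in> {i, j} \<Longrightarrow> min_height \<alpha> 1 l \<eta> = 0"
  shows "chain_integral \<eta>" "depth \<eta> = 0" "dominant_part \<eta> = \<eta>"
proof -
  have *: "chain_inf \<alpha> a b \<eta> k t = 0" if "(a, b) \<in> orders" "t \<in> {0..1}" "k \<le> m" for a b k t
    using chain_inf_dominant[OF \<eta> _ that] dom by blast
  show "chain_integral \<eta>" using * by (auto simp: chain_integral_def)
  show "depth \<eta> = 0" by (simp add: depth_def * orders_def)
  show "dominant_part \<eta> = \<eta>"
    using \<eta> by (auto simp: dominant_part_def * orders_def fun_eq_iff integral_path_def extensional_def)
qed

lemma min_height_Ints:
  assumes "chain_integral \<eta>" "l \<in> {i, j}"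
  shows "min_height \<alpha> 1 l \<eta> \<in> \<int>"
proof -
  have "\<exists>b. (l, b) \<in> orders" using assms(2) by (auto simp: orders_def)
  then obtain b where b: "(l, b) \<in> orders" ..
  have "\<forall>k<m. chain_inf \<alpha> l b \<eta> k 1 \<in> \<int>"
    using assms(1) b unfolding chain_integral_def by auto
  moreover have "1 < m" using m by simp
  ultimately have "chain_inf \<alpha> l b \<eta> 1 1 \<in> \<int>" by blast
  then show ?thesis by (simp add: min_height_def)
qed

context
  fixes \<eta> \<eta>' l
  assumes \<eta>: "integral_path \<alpha> \<eta>" and l: "l \<in> {i, j}"
    and M: "min_height \<alpha> 1 l \<eta> \<in> \<int>" and f: "root_f \<alpha> 1 l \<eta> = Some \<eta>'"
begin

lemmas root_f_D = root_f_SomeD[OF \<eta> M f]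

lemma chain_inf_step:
  assumes ab: "(a, b) \<in> orders" and k: "k \<le> m" and t: "t \<in> {0..1}"
  shows "letter a b k = l \<Longrightarrow> chain_inf \<alpha> a b \<eta>' k t
           = chain_inf \<alpha> a b \<eta> k t - chain_coeff \<alpha> a b k * cutoff (path_height \<alpha> l \<eta>) t"
    and "letter a b k \<noteq> l \<Longrightarrow> k = Suc r \<Longrightarrow> chain_inf \<alpha> a b \<eta>' k t
           = (INF s\<in>{0..t}. (chain_inf \<alpha> a b \<eta> r s + chain_coeff \<alpha> a b k * path_height \<alpha> (letter a b k) \<eta> s)
                + chain_coeff \<alpha> a b (Suc k) * cutoff (path_height \<alpha> l \<eta>) s)"
  by (rule chain_inf_reflect[OF _ _ root_f_D(1) cartan_diag ordersD(1)[OF ab] ordersD(2)[OF ab l]];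
      use \<eta> root_f_D(3) k t ordersD(3)[OF ab] in \<open>simp add: integral_path_def\<close>)+

text \<open>At length \<open>m - 1\<close> the coefficient is 1 and the next one is 0: a chain
  ending in \<open>l\<close> receives the whole correction, while for the other chain the remainder
  vanishes.\<close>

lemma full_chain_inf_step:
  assumes ab: "(a, b) \<in> orders" and t: "t \<in> {0..1}"
  shows "chain_inf \<alpha> a b \<eta>' (m - 1) t = chain_inf \<alpha> a b \<eta> (m - 1) t
    - (if letter a b (m - 1) = l then cutoff (path_height \<alpha> l \<eta>) t else 0)"
proof (cases "letter a b (m - 1) = l")
  case True
  then show ?thesis using chain_inf_step(1)[OF ab _ t, of "m - 1"] ordersD(4)[OF ab] by simp
next
  case False
  obtain r where r: "m - 1 = Suc r" "m = Suc (Suc r)" using m by (metis Suc_diff_1 add_2_eq_Suc le_Suc_ex plus_1_eq_Suc add_diff_cancel_left')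
  then show ?thesis
    using chain_inf_step(2)[OF ab _ t False r(1)] False ordersD(5)[OF ab]
    by (simp del: chain_coeff.simps)
qed

text \<open>Exactly one of the two full chains ends in \<open>l\<close>, and it drops by the final
  value 1 of the cutoff.\<close>

lemma depth_step: "depth \<eta>' = depth \<eta> + 1"
  using full_chain_inf_step[of i j 1] full_chain_inf_step[of j i 1] root_f_D(2) neq l
  by (auto simp: depth_def orders_def letter_def)

text \<open>The multiple of \<open>\<alpha> l\<close> taken away from the path is also taken away
  from the full chain that multiplies \<open>\<alpha> l\<close>, so the two changes cancel.\<close>

lemma dominant_part_step: "dominant_part \<eta>' = dominant_part \<eta>"
proof -
  have "\<eta>' t - chain_inf \<alpha> i j \<eta>' (m - 1) t *\<^sub>R \<alpha> (letter i j (m - 1))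
    - chain_inf \<alpha> j i \<eta>' (m - 1) t *\<^sub>R \<alpha> (letter j i (m - 1))
    = \<eta> t - chain_inf \<alpha> i j \<eta> (m - 1) t *\<^sub>R \<alpha> (letter i j (m - 1))
    - chain_inf \<alpha> j i \<eta> (m - 1) t *\<^sub>R \<alpha> (letter j i (m - 1))" if t: "t \<in> {0..1}" for t
  proof -
    have ij: "(i, j) \<in> orders" "(j, i) \<in> orders" by (simp_all add: orders_def)
    have "letter i j (m - 1) = i \<and> letter j i (m - 1) = j \<or>
        letter i j (m - 1) = j \<and> letter j i (m - 1) = i"
      by (simp only: letter_def split: if_split) blast
    then consider "letter i j (m - 1) = l" "letter j i (m - 1) \<noteq> l"
      | "letter i j (m - 1) \<noteq> l" "letter j i (m - 1) = l"
      using neq l by fastforce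
    then show ?thesis
      unfolding full_chain_inf_step[OF ij(1) t] full_chain_inf_step[OF ij(2) t] root_f_D(1)[OF t]
      by cases (simp_all add: algebra_simps)
  qed
  then show ?thesis by (auto simp: dominant_part_def fun_eq_iff)
qed

text \<open>A chain ending in \<open>l\<close> drops by an integer, and a full chain ending in the
  other letter is unchanged. For a shorter chain ending in the other letter,
  \<open>running_inf_cutoff\<close> gives a minimum of two integers; the chain of length
  \<open>k + 1\<close> occurring there is still shorter than \<open>m\<close>.\<close>

lemma chain_integral_step:
  assumes int: "chain_integral \<eta>"
  shows "chain_integral \<eta>'"
proof -
  have "chain_inf \<alpha> a b \<eta>' k 1 \<in> \<int>" if ab: "(a, b) \<in> orders" and k: "k < m" for a b k
  proof (cases "letter a b k = l")
    case True
    then show ?thesis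
      using chain_inf_step(1)[OF ab, of k 1] int ab k root_f_D(2) chain_coeff_Ints[of a b k]
      by (auto simp: chain_integral_def)
  next
    case False
    show ?thesis
    proof (cases "k = m - 1")
      case True
      then show ?thesis using full_chain_inf_step[OF ab, of 1] False int ab k
        by (auto simp: chain_integral_def)
    next
      case km: False
      show ?thesis
      proof (cases k)
        case (Suc r)
        let ?d = "chain_coeff \<alpha> a b (Suc k)"
        define F where "F s = chain_inf \<alpha> a b \<eta> r s + chain_coeff \<alpha> a b k * path_height \<alpha> (letter a b k) \<eta> s" for s
        have c: "continuous_on {0..1} \<eta>" using \<eta> by (simp add: integral_path_def)
        have bF: "bdd_below (F ` {0..1})"
          unfolding F_def using k Suc
          by (intro bdd_below_add_mult bdd_below_chain_inf bdd_below_continuous_on_Icc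
                continuous_on_path_height c ordersD(3)[OF ab]) auto
        have Fk: "(INF s\<in>{0..u}. F s) = chain_inf \<alpha> a b \<eta> k u" for u
          by (simp add: F_def Suc)
        have l': "letter a b (Suc k) = l"
          using False ordersD(2)[OF ab l] by (auto simp: letter_def split: if_splits)
        have Fk': "(INF u\<in>{0..1}. (INF s\<in>{0..u}. F s) + ?d * path_height \<alpha> l \<eta> u) = chain_inf \<alpha> a b \<eta> (Suc k) 1"
          unfolding Fk by (simp add: l')
        have "chain_inf \<alpha> a b \<eta>' k 1 = (INF s\<in>{0..1}. F s + ?d * cutoff (path_height \<alpha> l \<eta>) s)"
          using chain_inf_step(2)[OF ab _ _ False Suc, of 1] k by (simp add: F_def)
        also have "\<dots> = min (chain_inf \<alpha> a b \<eta> k 1 + ?d)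
            (chain_inf \<alpha> a b \<eta> (Suc k) 1 - ?d * min_height \<alpha> 1 l \<eta>)"
          using running_inf_cutoff[OF integral_path_height(1)[OF \<eta>] bF ordersD(3)[OF ab], of "Suc k" l] k
          unfolding Fk' unfolding Fk min_height_def by simp
        also have "\<dots> \<in> \<int>"
          using int ab k km M chain_coeff_Ints[of a b "Suc k"]
          by (auto simp: chain_integral_def min_def simp del: chain_inf.simps)
        finally show ?thesis .
      qed simp
    qed
  qed
  then show ?thesis by (auto simp: chain_integral_def)
qed

end

text \<open>Applying root operators to a path leads, by finiteness of the depth of the reversed path, to
  a path whose reversal is dominant; read backwards, this generates the reversal of the original
  path from a dominant one.\<close>

lemma chain_integral_rev_path:
  assumes "integral_path \<alpha> \<eta>" "chain_integral \<eta>"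
  shows "chain_integral (rev_path \<eta>)"
  using assms
proof (induction "nat \<lfloor>depth (rev_path \<eta>)\<rfloor>" arbitrary: \<eta> rule: less_induct)
  case less
  note \<eta> = less.prems(1)
  show ?case
  proof (cases "\<exists>l\<in>{i, j}. root_f \<alpha> 1 l \<eta> \<noteq> None")
    case True
    then obtain l \<eta>' where l: "l \<in> {i, j}" and f: "root_f \<alpha> 1 l \<eta> = Some \<eta>'" by blast
    note M = min_height_Ints[OF less.prems(2) l]
    note D = root_f_SomeD[OF \<eta> M f]
    note \<eta>'r = integral_path_rev_path[OF D(3)]
    have M': "min_height \<alpha> 1 l (rev_path \<eta>') \<in> \<int>"
      using M D(4) integral_path_height(3)[OF D(3)] by (simp add: min_height_rev_path[OF D(3)])
    note f' = root_f_rev_path[OF \<eta> M f]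
    have "depth (rev_path \<eta>) = depth (rev_path \<eta>') + 1"
      by (rule depth_step[OF \<eta>'r l M' f'])
    then have "nat \<lfloor>depth (rev_path \<eta>')\<rfloor> < nat \<lfloor>depth (rev_path \<eta>)\<rfloor>"
      using nat_floor_less_add_1[OF depth_nonneg[OF \<eta>'r]] by simp
    then have "chain_integral (rev_path \<eta>')"
      using less.hyps D(3) chain_integral_step[OF \<eta> l M f less.prems(2)] by blast
    then show ?thesis by (rule chain_integral_step[OF \<eta>'r l M' f'])
  next
    case False
    have "min_height \<alpha> 1 l (rev_path \<eta>) = 0" if "l \<in> {i, j}" for l
      using False that unfolding min_height_rev_path[OF \<eta>]
      by (auto simp: root_f_def split: if_splits)
    then show ?thesis by (rule dominant(1)[OF integral_path_rev_path[OF \<eta>]])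
  qed
qed

text \<open>The preimage is what the operator usually called \<open>e\<close> would give: reverse,
  apply \<open>root_f\<close>, reverse again. Stability of integrality under reversal licenses
  this.\<close>

lemma root_f_preimage:
  assumes \<eta>: "integral_path \<alpha> \<eta>" and int: "chain_integral \<eta>"
    and l: "l \<in> {i, j}" and M: "min_height \<alpha> 1 l \<eta> \<noteq> 0"
  obtains \<zeta> where "integral_path \<alpha> \<zeta>" "chain_integral \<zeta>" "root_f \<alpha> 1 l \<zeta> = Some \<eta>"
proof -
  note \<eta>r = integral_path_rev_path[OF \<eta>]
  note intr = chain_integral_rev_path[OF \<eta> int]
  have "path_height \<alpha> l (rev_path \<eta>) 1 \<noteq> min_height \<alpha> 1 l (rev_path \<eta>)"
    using M path_height_rev_path[of 1 \<alpha> l \<eta>] min_height_rev_path[OF \<eta>, of l] 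
      integral_path_height(2)[OF \<eta>, of l] by simp
  then obtain \<xi> where f: "root_f \<alpha> 1 l (rev_path \<eta>) = Some \<xi>" by (simp add: root_f_def)
  note Mr = min_height_Ints[OF intr l]
  have \<xi>: "integral_path \<alpha> \<xi>" by (rule root_f_SomeD(3)[OF \<eta>r Mr f])
  show thesis
  proof (rule that)
    show "integral_path \<alpha> (rev_path \<xi>)" by (rule integral_path_rev_path[OF \<xi>])
    show "chain_integral (rev_path \<xi>)"
      by (rule chain_integral_rev_path[OF \<xi> chain_integral_step[OF \<eta>r l Mr f intr]])
    show "root_f \<alpha> 1 l (rev_path \<xi>) = Some \<eta>"
      using root_f_rev_path[OF \<eta>r Mr f] by (simp add: rev_path_rev_path[OF \<eta>])
  qed
qed

text \<open>Going back through preimages lowers the depth by 1 each time and preserves the dominant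
  part; where no preimage is available, the path is its own dominant part.\<close>

lemma reach_from_dominant_part:
  assumes "integral_path \<alpha> \<eta>" "chain_integral \<eta>"
  shows "\<exists>n. real n = depth \<eta> \<and> reach \<alpha> {i, j} (dominant_part \<eta>) n \<eta>"
  using assms
proof (induction "nat \<lfloor>depth \<eta>\<rfloor>" arbitrary: \<eta> rule: less_induct)
  case less
  show ?case
  proof (cases "\<forall>l\<in>{i, j}. min_height \<alpha> 1 l \<eta> = 0")
    case True
    then show ?thesis using dominant[OF less.prems(1)] by (metis of_nat_0 reach.start)
  next
    case False
    then obtain l where l: "l \<in> {i, j}" and "min_height \<alpha> 1 l \<eta> \<noteq> 0" by blast
    then obtain \<zeta> where \<zeta>: "integral_path \<alpha> \<zeta>" "chain_integral \<zeta>" and f: "root_f \<alpha> 1 l \<zeta> = Some \<eta>"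
      using root_f_preimage[OF less.prems] by metis
    note step = \<zeta>(1) l min_height_Ints[OF \<zeta>(2) l] f
    have d: "depth \<eta> = depth \<zeta> + 1" and p: "dominant_part \<eta> = dominant_part \<zeta>"
      by (rule depth_step[OF step], rule dominant_part_step[OF step])
    then have "nat \<lfloor>depth \<zeta>\<rfloor> < nat \<lfloor>depth \<eta>\<rfloor>"
      using nat_floor_less_add_1[OF depth_nonneg[OF \<zeta>(1)]] by simp
    then obtain n where "real n = depth \<zeta>" "reach \<alpha> {i, j} (dominant_part \<zeta>) n \<zeta>"
      using less.hyps \<zeta> by blast
    then show ?thesis
      unfolding d p by (intro exI[of _ "Suc n"]) (auto intro: reach.step[OF _ l f])
  qed
qed

end

subsection \<open>Cartan integers of simple roots\<close>

lemma le_numeral_nat_cases: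
  "(k :: nat) \<le> 2 \<longleftrightarrow> k \<in> {0, 1, 2}"
  "(k :: nat) \<le> 3 \<longleftrightarrow> k \<in> {0, 1, 2, 3}"
  "(k :: nat) \<le> 4 \<longleftrightarrow> k \<in> {0, 1, 2, 3, 4}"
  "(k :: nat) \<le> 6 \<longleftrightarrow> k \<in> {0, 1, 2, 3, 4, 5, 6}"
  unfolding insert_iff empty_iff by presburger+

lemma chain_coeff_numeral:
  fixes \<alpha> :: "'n \<Rightarrow> 'v::euclidean_space" and a b :: 'n
  defines "p \<equiv> - cartan \<alpha> b a" and "q \<equiv> - cartan \<alpha> a b"
  shows "chain_coeff \<alpha> a b 2 = p" "chain_coeff \<alpha> a b 3 = p * q - 1"
    "chain_coeff \<alpha> a b 4 = p * (p * q - 2)" "chain_coeff \<alpha> a b 5 = p * q * (p * q - 2) - (p * q - 1)"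
    "chain_coeff \<alpha> a b 6 = p * (p * q * (p * q - 2) - (p * q - 1)) - p * (p * q - 2)"
  unfolding p_def q_def by (simp_all add: eval_nat_numeral algebra_simps)

text \<open>The product of the two Cartan integers is 0, 1, 2 or 3, and the corresponding orders of
  the product of the two reflections are 2, 3, 4 and 6.\<close>

lemma closing_exists:
  fixes \<alpha> :: "'n \<Rightarrow> 'v::euclidean_space"
  assumes "(cartan \<alpha> a b, cartan \<alpha> b a) \<in> {(0, 0), (-1, -1), (-1, -2), (-2, -1), (-1, -3), (-3, -1)}"
  shows "\<exists>m\<ge>2. closing \<alpha> m a b \<and> closing \<alpha> m b a"
proof -
  note eval = closing_def le_numeral_nat_cases chain_coeff_numeral
  consider "cartan \<alpha> a b * cartan \<alpha> b a = 0" | "cartan \<alpha> a b * cartan \<alpha> b a = 1"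
    | "cartan \<alpha> a b * cartan \<alpha> b a = 2" | "cartan \<alpha> a b * cartan \<alpha> b a = 3"
    using assms by fastforce
  then show ?thesis
  proof cases
    case 1
    then show ?thesis using assms by (intro exI[of _ 2]) (auto simp: eval)
  next
    case 2
    then show ?thesis using assms by (intro exI[of _ 3]) (auto simp: eval)
  next
    case 3
    then show ?thesis using assms by (intro exI[of _ 4]) (auto simp: eval)
  next
    case 4
    then show ?thesis using assms by (intro exI[of _ 6]) (auto simp: eval)
  qed
qed

lemma independent_family_eq:
  fixes \<alpha> :: "'n::finite \<Rightarrow> 'v::euclidean_space"
  assumes "inj \<alpha>" "independent (range \<alpha>)"
    and eq: "(\<Sum>k\<in>UNIV. u k *\<^sub>R \<alpha> k) = (\<Sum>k\<in>UNIV. w k *\<^sub>R \<alpha> k)"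
  shows "u = w"
proof
  fix k
  have "(\<Sum>v\<in>range \<alpha>. (u (inv \<alpha> v) - w (inv \<alpha> v)) *\<^sub>R v) = (\<Sum>k\<in>UNIV. (u k - w k) *\<^sub>R \<alpha> k)"
    using assms(1) by (simp add: sum.reindex)
  also have "\<dots> = 0" using eq by (simp add: scaleR_diff_left sum_subtractf)
  finally have "u (inv \<alpha> (\<alpha> k)) - w (inv \<alpha> (\<alpha> k)) = 0"
    by (intro independentD[OF assms(2) _ order.refl]) auto
  then show "u k = w k" using assms(1) by simp
qed

context
  fixes \<Phi> :: "'v::euclidean_space set" and \<alpha> :: "'n::finite \<Rightarrow> 'v"
  assumes \<Phi>: "root_system \<Phi>" and \<alpha>: "simple_roots \<Phi> \<alpha>"
begin

lemma simple_root_in [simp]: "\<alpha> k \<in> \<Phi>"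
  using \<alpha> by (auto simp: simple_roots_def)

lemma simple_root_nonzero: "\<alpha> k \<noteq> 0"
  using simple_root_in[of k] \<Phi> by (metis root_system_def)

lemma simple_roots_indep: "inj \<alpha>" "independent (range \<alpha>)"
  using \<alpha> by (auto simp: simple_roots_def)

lemma cartan_roots_simple: "cartan_roots \<alpha>"
proof
  show "cartan \<alpha> k l \<in> \<int>" for k l
    using \<Phi> simple_root_in unfolding root_system_def cartan_def by metis
  show "cartan \<alpha> l l = 2" for l
    using simple_root_nonzero[of l] by (simp add: cartan_def coroot_def)
qed

text \<open>The reflection of \<open>\<alpha> a\<close> in \<open>\<alpha> b\<close> is a root with
  coordinate 1 at \<open>a\<close> and \<open>- cartan \<alpha> a b\<close> at \<open>b\<close>, and
  the coordinates of a root cannot have opposite signs.\<close>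

lemma cartan_nonpos:
  assumes "a \<noteq> b"
  shows "cartan \<alpha> a b \<le> 0"
proof -
  let ?r = "\<lambda>k. (if k = a then 1 else 0) - (if k = b then cartan \<alpha> a b else 0)"
  have r: "root_reflection (\<alpha> b) (\<alpha> a) = (\<Sum>k\<in>UNIV. ?r k *\<^sub>R \<alpha> k)"
    by (simp add: root_reflection_def cartan_def scaleR_diff_left sum_subtractf
        if_distrib[of "\<lambda>x. x *\<^sub>R _"] cong: if_cong)
  have "root_reflection (\<alpha> b) (\<alpha> a) \<in> \<Phi>"
    using \<Phi> simple_root_in unfolding root_system_def by metis
  then obtain c :: "'n \<Rightarrow> nat" where
    "root_reflection (\<alpha> b) (\<alpha> a) = (\<Sum>k\<in>UNIV. of_nat (c k) *\<^sub>R \<alpha> k) \<or>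
     root_reflection (\<alpha> b) (\<alpha> a) = - (\<Sum>k\<in>UNIV. of_nat (c k) *\<^sub>R \<alpha> k)"
    using \<alpha> unfolding simple_roots_def by blast
  then have "(\<Sum>k\<in>UNIV. ?r k *\<^sub>R \<alpha> k) = (\<Sum>k\<in>UNIV. real (c k) *\<^sub>R \<alpha> k) \<or>
     (\<Sum>k\<in>UNIV. ?r k *\<^sub>R \<alpha> k) = (\<Sum>k\<in>UNIV. (- real (c k)) *\<^sub>R \<alpha> k)"
    unfolding r by (simp add: sum_negf)
  then show ?thesis
  proof
    assume "(\<Sum>k\<in>UNIV. ?r k *\<^sub>R \<alpha> k) = (\<Sum>k\<in>UNIV. real (c k) *\<^sub>R \<alpha> k)"
    then have "?r = (\<lambda>k. real (c k))" by (rule independent_family_eq[OF simple_roots_indep])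
    from fun_cong[OF this, of b] show ?thesis using assms by simp
  next
    assume "(\<Sum>k\<in>UNIV. ?r k *\<^sub>R \<alpha> k) = (\<Sum>k\<in>UNIV. (- real (c k)) *\<^sub>R \<alpha> k)"
    then have "?r = (\<lambda>k. - real (c k))" by (rule independent_family_eq[OF simple_roots_indep])
    from fun_cong[OF this, of a] show ?thesis using assms by simp
  qed
qed

text \<open>Strict Cauchy-Schwarz bounds the product of the two nonpositive integers below 4, and
  they vanish together.\<close>

lemma cartan_finite_type:
  assumes "a \<noteq> b"
  shows "(cartan \<alpha> a b, cartan \<alpha> b a) \<in> {(0, 0), (-1, -1), (-1, -2), (-2, -1), (-1, -3), (-3, -1)}"
proof -
  interpret cartan_roots \<alpha> by (rule cartan_roots_simple)
  let ?x = "\<alpha> a" and ?y = "\<alpha> b"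
  have pos: "?x \<bullet> ?x > 0" "?y \<bullet> ?y > 0" using simple_root_nonzero by auto
  \<comment> \<open>The component of \<open>\<alpha> a\<close> orthogonal to
    \<open>\<alpha> b\<close>; its positive squared length is the strict Cauchy-Schwarz
    inequality.\<close>
  let ?w = "?x - ((?x \<bullet> ?y) / (?y \<bullet> ?y)) *\<^sub>R ?y"
  have "?w \<noteq> 0"
  proof
    assume "?w = 0"
    then have "?x \<in> span (range \<alpha> - {?x})"
      using assms simple_roots_indep(1)
      by (metis DiffI eq_iff_diff_eq_0 inj_eq insert_iff empty_iff rangeI span_base span_scale)
    then show False using simple_roots_indep(2) by (auto simp: dependent_def)
  qed
  then have "0 < ?w \<bullet> ?w" by simp
  also have "?w \<bullet> ?w = ?x \<bullet> ?x - (?x \<bullet> ?y)\<^sup>2 / (?y \<bullet> ?y)"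
    using pos by (simp add: inner_diff_left inner_diff_right inner_commute power2_eq_square field_simps)
  finally have lt: "(?x \<bullet> ?y)\<^sup>2 < (?x \<bullet> ?x) * (?y \<bullet> ?y)"
    using pos by (simp add: field_simps)
  have eq: "cartan \<alpha> a b * cartan \<alpha> b a = 4 * (?x \<bullet> ?y)\<^sup>2 / ((?x \<bullet> ?x) * (?y \<bullet> ?y))"
    using pos by (simp add: cartan_def coroot_def inner_commute power2_eq_square field_simps)
  have less: "cartan \<alpha> a b * cartan \<alpha> b a < 4"
    unfolding eq using pos lt by (simp add: field_simps)
  have zero: "cartan \<alpha> a b = 0 \<longleftrightarrow> cartan \<alpha> b a = 0"
    using pos by (simp add: cartan_def coroot_def inner_commute)
  obtain x y :: int where xy: "cartan \<alpha> a b = - of_int x" "cartan \<alpha> b a = - of_int y"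
    using cartan_Ints by (metis Ints_cases minus_minus of_int_minus)
  have "0 \<le> x" "0 \<le> y" using cartan_nonpos[of a b] cartan_nonpos[of b a] assms xy by auto
  moreover have "x * y < 4" using less xy by (simp flip: of_int_mult)
  moreover have z: "x = 0 \<longleftrightarrow> y = 0" using zero xy by simp
  ultimately have "(x, y) \<in> {(0, 0), (1, 1), (1, 2), (2, 1), (1, 3), (3, 1)}"
  proof (cases "x = 0")
    case False
    then have 1: "1 \<le> x" "1 \<le> y" using z \<open>0 \<le> x\<close> \<open>0 \<le> y\<close> by auto
    then have "x \<le> x * y" "y \<le> x * y" by (simp_all add: mult_le_cancel_left1 mult_le_cancel_right1)
    then have "x \<le> 3" "y \<le> 3" using \<open>x * y < 4\<close> by linarith+
    then have "x = 1 \<or> x = 2 \<or> x = 3" "y = 1 \<or> y = 2 \<or> y = 3" using 1 by linarith+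
    then show ?thesis using \<open>x * y < 4\<close> by auto
  qed auto
  then show ?thesis unfolding xy by auto
qed

lemma rank_two_exists:
  assumes "a \<noteq> b"
  shows "\<exists>m. rank_two \<alpha> a b m"
  using closing_exists[OF cartan_finite_type[OF assms]] cartan_roots_simple assms
  by (auto simp: rank_two_def rank_two_axioms_def)

section \<open>Fundamental weights and integrality on the weight lattice\<close>

lemma span_simple_roots: "span (range \<alpha>) = UNIV"
proof -
  have "\<beta> \<in> span (range \<alpha>)" if \<beta>: "\<beta> \<in> \<Phi>" for \<beta>
  proof -
    obtain c :: "'n \<Rightarrow> nat" where
      "\<beta> = (\<Sum>i\<in>UNIV. of_nat (c i) *\<^sub>R \<alpha> i) \<or> \<beta> = - (\<Sum>i\<in>UNIV. of_nat (c i) *\<^sub>R \<alpha> i)"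
      using \<alpha> \<beta> unfolding simple_roots_def by blast
    moreover have "(\<Sum>i\<in>UNIV. real (c i) *\<^sub>R \<alpha> i) \<in> span (range \<alpha>)"
      by (intro span_sum span_scale span_base) simp
    ultimately show ?thesis by (metis span_neg)
  qed
  then have "span \<Phi> \<subseteq> span (range \<alpha>)"
    by (simp add: span_minimal subsetI)
  then show ?thesis using \<Phi> by (auto simp: root_system_def)
qed

text \<open>The definite description is justified here: a functional dual to the simple roots,
  represented by the scalar product, gives existence, and spanning gives uniqueness.\<close>

lemma fundamental_weight_coroot:
  "fundamental_weight \<alpha> k \<bullet> coroot (\<alpha> l) = (if l = k then 1 else 0)"
proof -
  \<comment> \<open>The value \<open>(v \<bullet> v) / 2\<close> compensates the normalization of
    the coroot.\<close>
  obtain f where f: "linear f" "\<And>v. v \<in> range \<alpha> \<Longrightarrow> f v = (if v = \<alpha> k then (v \<bullet> v) / 2 else 0 :: real)"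
    using linear_independent_extend[OF simple_roots_indep(2),
        of "\<lambda>v. if v = \<alpha> k then (v \<bullet> v) / 2 else 0"] by blast
  define w where "w = (\<Sum>b\<in>Basis. f b *\<^sub>R b)"
  have wf: "w \<bullet> x = f x" for x
  proof -
    have "f x = f (\<Sum>b\<in>Basis. (x \<bullet> b) *\<^sub>R b)" by (simp add: euclidean_representation)
    also have "\<dots> = (\<Sum>b\<in>Basis. (x \<bullet> b) * f b)"
      by (simp add: linear_sum[OF f(1)] linear_cmul[OF f(1)])
    finally show ?thesis by (simp add: w_def inner_sum_left inner_commute[of x] mult.commute)
  qed
  have w: "w \<bullet> coroot (\<alpha> l) = (if l = k then 1 else 0)" for l
    using simple_root_nonzero[of k] f(2)[of "\<alpha> l"] simple_roots_indep(1)
    by (auto simp: coroot_def wf inj_eq)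
  have "\<exists>!w. \<forall>j. w \<bullet> coroot (\<alpha> j) = (if j = k then 1 else 0)"
  proof (rule ex1I[of _ w])
    fix v assume v: "\<forall>j. v \<bullet> coroot (\<alpha> j) = (if j = k then 1 else 0)"
    have "(v - w) \<bullet> \<alpha> j = 0" for j
    proof -
      have "(v - w) \<bullet> coroot (\<alpha> j) = 0" using v w by (simp add: inner_diff_left)
      then show ?thesis using simple_root_nonzero[of j] by (simp add: coroot_def)
    qed
    then have "orthogonal (v - w) x" if "x \<in> span (range \<alpha>)" for x
      using that by (intro orthogonal_to_span[of x "range \<alpha>"]) (auto simp: orthogonal_def)
    then have "orthogonal (v - w) (v - w)" by (simp add: span_simple_roots)
    then show "v = w" by (simp add: orthogonal_def)
  qed (use w in auto)
  from theI'[OF this] show ?thesis unfolding fundamental_weight_def by blast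
qed

lemma weight_lattice_coroot_Ints:
  assumes "x \<in> weight_lattice \<alpha>"
  shows "x \<bullet> coroot (\<alpha> l) \<in> \<int>"
proof -
  obtain c :: "'n \<Rightarrow> int" where "x = (\<Sum>i\<in>UNIV. of_int (c i) *\<^sub>R fundamental_weight \<alpha> i)"
    using assms by (auto simp: weight_lattice_def)
  then have "x \<bullet> coroot (\<alpha> l) = of_int (c l)"
    by (simp add: inner_sum_left fundamental_weight_coroot if_distrib cong: if_cong)
  then show ?thesis by simp
qed

lemma integral_path_elementary:
  assumes "elementary_path \<alpha> \<pi>"
  shows "integral_path \<alpha> \<pi>"
  using assms weight_lattice_coroot_Ints
  by (auto simp: elementary_path_def integral_path_def path_height_def)

subsection \<open>Integrality of the path crystal\<close>

text \<open>The induction carries, for every pair, that the dominant part is itself reachable and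
  that its number of steps plus the depth is \<open>n\<close>. Combined with
  \<open>reach_from_dominant_part\<close>, this bounds the number of steps to other predecessors of
  a path, so that the hypothesis applies to them too.\<close>

lemma reach_integral:
  assumes \<pi>: "integral_path \<alpha> \<pi>" and dom: "\<And>l. min_height \<alpha> 1 l \<pi> = 0"
  shows "reach \<alpha> UNIV \<pi> n \<eta> \<Longrightarrow> integral_path \<alpha> \<eta> \<and> (\<forall>l. min_height \<alpha> 1 l \<eta> \<in> \<int>) \<and>
    (\<forall>i j m. rank_two \<alpha> i j m \<longrightarrow> rank_two.chain_integral \<alpha> i j m \<eta> \<and>
       (\<exists>q. reach \<alpha> UNIV \<pi> q (rank_two.dominant_part \<alpha> i j m \<eta>) \<and>
            real n = real q + rank_two.depth \<alpha> i j m \<eta>))"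
proof (induction n arbitrary: \<eta>)
  case 0
  then have \<eta>: "\<eta> = \<pi>" by (auto elim: reach.cases)
  have "rank_two.chain_integral \<alpha> i j m \<pi> \<and>
       (\<exists>q. reach \<alpha> UNIV \<pi> q (rank_two.dominant_part \<alpha> i j m \<pi>) \<and>
            real 0 = real q + rank_two.depth \<alpha> i j m \<pi>)" if "rank_two \<alpha> i j m" for i j m
  proof -
    interpret rank_two \<alpha> i j m by fact
    show ?thesis using dominant[OF \<pi> dom] by (auto intro: reach.start)
  qed
  then show ?case using \<pi> dom unfolding \<eta> by simp
next
  case (Suc n)
  interpret cartan_roots \<alpha> by (rule cartan_roots_simple)
  obtain \<eta>0 l where \<eta>0: "reach \<alpha> UNIV \<pi> n \<eta>0" and f: "root_f \<alpha> 1 l \<eta>0 = Some \<eta>"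
    using Suc.prems by (auto elim: reach.cases)
  note IH = Suc.IH[OF \<eta>0]
  have int0: "integral_path \<alpha> \<eta>0" and M0: "min_height \<alpha> 1 l \<eta>0 \<in> \<int>" using IH by auto
  note D = root_f_SomeD[OF int0 M0 f]
  have M: "min_height \<alpha> 1 k \<eta> \<in> \<int>" for k
  proof (cases "k = l")
    case True
    then show ?thesis using D(4) M0 by simp
  next
    case False
    then obtain m where "rank_two \<alpha> k l m" using rank_two_exists by blast
    then interpret rank_two \<alpha> k l m .
    have "chain_integral \<eta>0" using IH rank_two_axioms by blast
    then have "chain_integral \<eta>" by (intro chain_integral_step[OF int0 _ M0 f]) auto
    then show ?thesis by (rule min_height_Ints) simp
  qed
  have "rank_two.chain_integral \<alpha> i j m \<eta> \<and>
       (\<exists>q. reach \<alpha> UNIV \<pi> q (rank_two.dominant_part \<alpha> i j m \<eta>) \<and>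
            real (Suc n) = real q + rank_two.depth \<alpha> i j m \<eta>)" if "rank_two \<alpha> i j m" for i j m
  proof -
    interpret rank_two \<alpha> i j m by fact
    \<comment> \<open>Any predecessor reachable in \<open>n\<close> steps along a letter of the pair
      suffices, not only the one from which the path was first obtained.\<close>
    have step: ?thesis if \<zeta>: "reach \<alpha> UNIV \<pi> n \<zeta>" and k: "k \<in> {i, j}" and f: "root_f \<alpha> 1 k \<zeta> = Some \<eta>" for \<zeta> k
    proof -
      have int: "integral_path \<alpha> \<zeta>" and M: "min_height \<alpha> 1 k \<zeta> \<in> \<int>" and ch: "chain_integral \<zeta>"
        and "\<exists>q. reach \<alpha> UNIV \<pi> q (dominant_part \<zeta>) \<and> real n = real q + depth \<zeta>"
        using Suc.IH[OF \<zeta>] rank_two_axioms by blast+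
      then show ?thesis
        using chain_integral_step[OF int k M f ch] depth_step[OF int k M f] dominant_part_step[OF int k M f]
        by auto
    qed
    show ?thesis
    proof (cases "l \<in> {i, j}")
      case True
      then show ?thesis using step[OF \<eta>0 _ f] by blast
    next
      case False
      show ?thesis
      proof (cases "\<forall>k\<in>{i, j}. min_height \<alpha> 1 k \<eta> = 0")
        case True
        then have "chain_integral \<eta>" "depth \<eta> = 0" "dominant_part \<eta> = \<eta>"
          using dominant[OF D(3)] by blast+
        then show ?thesis using Suc.prems by (intro conjI exI[of _ "Suc n"]) simp_all
      next
        \<comment> \<open>The last letter \<open>l\<close> is outside the pair, but the path can be
          left backwards along some \<open>k\<close> in the pair. The rank two crystal of
          \<open>k\<close> and \<open>l\<close> supplies a predecessor \<open>\<zeta>\<close> along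
          \<open>k\<close>.\<close>
        case nd: False
        then obtain k where k: "k \<in> {i, j}" "min_height \<alpha> 1 k \<eta> \<noteq> 0" by blast
        then have "k \<noteq> l" using False by blast
        then obtain m' where "rank_two \<alpha> k l m'" using rank_two_exists by blast
        then interpret R: rank_two \<alpha> k l m' .
        obtain q where ch: "R.chain_integral \<eta>0" and q: "reach \<alpha> UNIV \<pi> q (R.dominant_part \<eta>0)"
          and n: "real n = real q + R.depth \<eta>0"
          using IH R.rank_two_axioms by blast
        have l: "l \<in> {k, l}" by simp
        note s = R.chain_integral_step[OF int0 l M0 f ch] R.depth_step[OF int0 l M0 f]
          R.dominant_part_step[OF int0 l M0 f]
        obtain \<zeta> where \<zeta>: "integral_path \<alpha> \<zeta>" "R.chain_integral \<zeta>" and f': "root_f \<alpha> 1 k \<zeta> = Some \<eta>"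
          using R.root_f_preimage[OF D(3) s(1) _ k(2)] by auto
        have k': "k \<in> {k, l}" by simp
        note s' = R.depth_step[OF \<zeta>(1) k' R.min_height_Ints[OF \<zeta>(2) k'] f']
          R.dominant_part_step[OF \<zeta>(1) k' R.min_height_Ints[OF \<zeta>(2) k'] f']
        obtain r where r: "real r = R.depth \<zeta>" "reach \<alpha> {k, l} (R.dominant_part \<zeta>) r \<zeta>"
          using R.reach_from_dominant_part[OF \<zeta>] by blast
        \<comment> \<open>\<open>\<zeta>\<close> and \<open>\<eta>0\<close> both precede
          \<open>\<eta>\<close> by one step, so they share dominant part and depth for the pair
          \<open>k\<close>, \<open>l\<close>; hence \<open>\<zeta>\<close> is also reachable in
          exactly \<open>n\<close> steps.\<close>
        have "reach \<alpha> UNIV \<pi> (q + r) \<zeta>"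
          using reach_trans[OF q, of "{k, l}" r \<zeta>] r(2) s(3) s'(2) by simp
        moreover have "real (q + r) = real n" using n r(1) s(2) s'(1) by simp
        then have "q + r = n" by (simp only: of_nat_eq_iff)
        ultimately show ?thesis using step[OF _ k(1) f'] by simp
      qed
    qed
  qed
  then show ?case using D(3) M by blast
qed

lemma path_crystal_integral:
  assumes \<pi>: "integral_path \<alpha> \<pi>" and dom: "\<pi> ` {0..1} \<subseteq> dominant_chamber \<alpha>"
    and \<eta>: "\<eta> \<in> path_crystal \<alpha> \<pi>"
  shows "integral_path \<alpha> \<eta>" "min_height \<alpha> 1 l \<eta> \<in> \<int>"
proof -
  have "min_height \<alpha> 1 l \<pi> = 0" for l
  proof -
    have "0 \<le> min_height \<alpha> 1 l \<pi>"
      unfolding min_height_def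
    proof (rule cINF_greatest)
      fix t :: real assume "t \<in> {0..1}"
      then have "\<pi> t \<in> dominant_chamber \<alpha>" using dom by blast
      then show "0 \<le> path_height \<alpha> l \<pi> t" by (simp add: dominant_chamber_def path_height_def)
    qed simp
    then show ?thesis using min_height_nonpos[OF \<pi>, of l] by simp
  qed
  moreover have "\<exists>n. reach \<alpha> UNIV \<pi> n \<eta>"
    using \<eta> by induction (auto intro: reach.intros)
  ultimately show "integral_path \<alpha> \<eta>" "min_height \<alpha> 1 l \<eta> \<in> \<int>"
    using reach_integral[OF \<pi>] by blast+
qed

lemma path_crystal_weight_step:
  assumes "integral_path \<alpha> \<pi>" "\<pi> ` {0..1} \<subseteq> dominant_chamber \<alpha>" "\<eta> \<in> path_crystal \<alpha> \<pi>"
    and f: "root_f \<alpha> 1 l \<eta> = Some \<eta>'"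
  shows "\<eta>' 1 = \<eta> 1 - \<alpha> l"
  using cartan_roots.root_f_SomeD(1,2)[OF cartan_roots_simple path_crystal_integral[OF assms(1-3)] f]
  by simp

end

subsection \<open>Random trajectories\<close>

lemma trajectory_endpoint:
  assumes "1 \<le> l"
  shows "trajectory l \<omega> (real l) = (\<Sum>k<l. \<omega> k 1)"
proof -
  obtain r where r: "l = Suc r" using assms by (metis Suc_le_D One_nat_def)
  then have "nat (\<lceil>real l\<rceil> - 1) = r" by (simp only: ceiling_of_nat)
  moreover have "real l - real r = 1" by (simp add: r)
  ultimately show ?thesis by (simp add: trajectory_def Let_def) (simp add: r)
qed

text \<open>The factors are recovered one after the other: once the earlier ones agree, their
  endpoints agree, and the next factor is read off its own unit interval.\<close>

lemma trajectory_eq_iff: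
  fixes \<omega> \<omega>' :: "nat \<Rightarrow> 'v::euclidean_space lpath"
  assumes l: "1 \<le> l" and \<omega>: "\<And>k. k < l \<Longrightarrow> \<omega> k \<in> extensional {0..1} \<and> \<omega> k 0 = 0"
    and \<omega>': "\<And>k. k < l \<Longrightarrow> \<omega>' k \<in> extensional {0..1} \<and> \<omega>' k 0 = 0"
  shows "trajectory l \<omega> = trajectory l \<omega>' \<longleftrightarrow> (\<forall>k<l. \<omega> k = \<omega>' k)"
proof
  assume eq: "trajectory l \<omega> = trajectory l \<omega>'"
  have "k < l \<longrightarrow> \<omega> k = \<omega>' k" for k
  proof (induction k rule: less_induct)
    case (less k)
    show ?case
    proof
      assume k: "k < l"
      have sums: "(\<Sum>j<k. \<omega> j 1) = (\<Sum>j<k. \<omega>' j 1)"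
        using less k by (intro sum.cong) auto
      have "\<omega> k t = \<omega>' k t" for t
      proof -
        \<comment> \<open>The time \<open>t = 0\<close> is separate because at integer times the
          ceiling selects the preceding factor.\<close>
        consider "t \<notin> {0..1}" | "t = 0" | "0 < t" "t \<le> 1" by force
        then show ?thesis
        proof cases
          case 1
          then show ?thesis using \<omega>[OF k] \<omega>'[OF k] by (simp add: extensional_def)
        next
          case 2
          then show ?thesis using \<omega>[OF k] \<omega>'[OF k] by simp
        next
          case 3
          have "\<lceil>real k + t\<rceil> = int k + 1"
            using 3 by (intro ceiling_unique) auto
          then have "nat (\<lceil>real k + t\<rceil> - 1) = k" by simp
          moreover have "real k + t \<in> {0..real l}"
            using 3 k by (simp add: order_trans[of _ "real k + 1"])
          ultimately have "trajectory l \<xi> (real k + t) = (\<Sum>j<k. \<xi> j 1) + \<xi> k t"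
            for \<xi> :: "nat \<Rightarrow> 'v lpath"
            by (simp add: trajectory_def Let_def)
          then show ?thesis using eq sums by (metis add_left_cancel)
        qed
      qed
      then show "\<omega> k = \<omega>' k" by blast
    qed
  qed
  then show "\<forall>k<l. \<omega> k = \<omega>' k" by blast
next
  assume eq: "\<forall>k<l. \<omega> k = \<omega>' k"
  show "trajectory l \<omega> = trajectory l \<omega>'"
  proof
    fix t
    show "trajectory l \<omega> t = trajectory l \<omega>' t"
    proof (cases "t \<in> {0..real l}")
      case True
      then have "\<lceil>t\<rceil> \<le> int l" by (simp add: ceiling_le_iff)
      then have "nat (\<lceil>t\<rceil> - 1) < l" using l by linarith
      then show ?thesis using eq True by (auto simp: trajectory_def Let_def intro!: sum.cong)
    qed (auto simp: trajectory_def)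
  qed
qed

text \<open>By injectivity of concatenation the cylinder fixes the first \<open>l\<close>
  coordinates. The further requirement that all coordinates lie in \<open>B\<close> holds almost
  surely, so the product formula applies.\<close>

lemma measure_cylinder:
  fixes p :: "'v::euclidean_space lpath pmf"
  assumes B: "set_pmf p = B" and paths: "\<And>\<eta>. \<eta> \<in> B \<Longrightarrow> \<eta> \<in> extensional {0..1} \<and> \<eta> 0 = 0"
    and l: "1 \<le> l" and \<omega>: "\<omega> \<in> {..<l} \<rightarrow> B"
  shows "measure (product_law p) (cylinder B l (trajectory l \<omega>)) = (\<Prod>k<l. pmf p (\<omega> k))"
proof -
  interpret product_prob_space "\<lambda>_::nat. measure_pmf p" UNIV
    by (rule product_prob_spaceI) (rule measure_pmf.prob_space_axioms)
  let ?M = "Pi\<^sub>M UNIV (\<lambda>_::nat. measure_pmf p)"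
  let ?X = "emb UNIV {..<l} (\<Pi>\<^sub>E k\<in>{..<l}. {\<omega> k})"
  have X: "?X = {\<xi>. \<forall>k<l. \<xi> k = \<omega> k}"
    by (subst prod_emb_PiE) (auto simp: PiE_UNIV_domain Pi_iff split: if_splits)
  have cyl: "cylinder B l (trajectory l \<omega>) = {\<xi>. (\<forall>k. \<xi> k \<in> B) \<and> \<xi> \<in> ?X}"
    unfolding X cylinder_def infinite_trajectories_def
  proof (intro Collect_cong)
    fix \<xi>
    have "trajectory l \<xi> = trajectory l \<omega> \<longleftrightarrow> (\<forall>k<l. \<xi> k = \<omega> k)" if "\<forall>k. \<xi> k \<in> B"
      using that \<omega> by (intro trajectory_eq_iff l paths) auto
    then show "(\<xi> \<in> UNIV \<rightarrow> B \<and> trajectory l \<xi> = trajectory l \<omega>) =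
        ((\<forall>k. \<xi> k \<in> B) \<and> \<xi> \<in> {\<xi>. \<forall>k<l. \<xi> k = \<omega> k})"
      by (auto simp: Pi_iff)
  qed
  have "AE \<xi> in ?M. \<forall>k. \<xi> k \<in> B"
    unfolding AE_all_countable
    by (intro allI AE_PiM_component) (auto simp: measure_pmf.prob_space_axioms B[symmetric] AE_measure_pmf)
  moreover have "cylinder B l (trajectory l \<omega>) \<in> sets ?M"
  proof -
    have [measurable]: "Measurable.pred ?M (\<lambda>\<xi>. \<xi> k \<in> A)" for k A
      by (rule measurable_compose[OF measurable_component_singleton]) simp_all
    have "cylinder B l (trajectory l \<omega>) = {\<xi>\<in>space ?M. (\<forall>k. \<xi> k \<in> B) \<and> (\<forall>k. k < l \<longrightarrow> \<xi> k \<in> {\<omega> k})}"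
      unfolding cyl X by (auto simp: space_PiM)
    also have "\<dots> \<in> sets ?M" by measurable
    finally show ?thesis .
  qed
  moreover have "?X \<in> sets ?M" by simp
  ultimately have "measure ?M (cylinder B l (trajectory l \<omega>)) = measure ?M ?X"
    unfolding cyl by (intro measure_eq_AE) auto
  also have "\<dots> = (\<Prod>k<l. pmf p (\<omega> k))"
    by (subst measure_PiM_emb) (auto simp: measure_pmf_single)
  finally show ?thesis by (simp add: product_law_def)
qed

lemma central_iff:
  fixes p :: "'v::euclidean_space lpath pmf"
  assumes B: "set_pmf p = B" and paths: "\<And>\<eta>. \<eta> \<in> B \<Longrightarrow> \<eta> \<in> extensional {0..1} \<and> \<eta> 0 = 0"
  shows "central B (product_law p) \<longleftrightarrow>
    (\<forall>l::nat\<ge>1. \<forall>\<omega>\<in>{..<l} \<rightarrow> B. \<forall>\<omega>'\<in>{..<l} \<rightarrow> B.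
       (\<Sum>k<l. \<omega> k 1) = (\<Sum>k<l. \<omega>' k 1) \<longrightarrow> (\<Prod>k<l. pmf p (\<omega> k)) = (\<Prod>k<l. pmf p (\<omega>' k)))"
  unfolding central_def trajectories_def
  by (simp add: measure_cylinder[OF B paths] trajectory_endpoint del: One_nat_def)

section \<open>Centrality and multiplicativity along arrows\<close>

theorem proposition4p3:
  fixes \<Phi> :: "'v::euclidean_space set"
    and \<alpha> :: "'n::finite \<Rightarrow> 'v"
    and \<kappa> :: 'v
    and \<pi>\<^sub>\<kappa> :: "'v lpath"
    and p :: "'v lpath pmf"
  assumes "irreducible_root_system \<Phi>"
    and "simple_roots \<Phi> \<alpha>"
    and "\<kappa> \<in> dominant_weights \<alpha>"
    and "elementary_path \<alpha> \<pi>\<^sub>\<kappa>"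
    and "\<pi>\<^sub>\<kappa> 1 = \<kappa>"
    and "\<pi>\<^sub>\<kappa> ` {0..1} \<subseteq> dominant_chamber \<alpha>"
    and "set_pmf p \<subseteq> path_crystal \<alpha> \<pi>\<^sub>\<kappa>"
    and "\<forall>\<pi>\<in>path_crystal \<alpha> \<pi>\<^sub>\<kappa>. pmf p \<pi> > 0"
  shows "central (path_crystal \<alpha> \<pi>\<^sub>\<kappa>) (product_law p) \<longleftrightarrow>
    (\<exists>\<tau> :: 'n \<Rightarrow> real. (\<forall>i. \<tau> i > 0) \<and>
      (\<forall>\<pi>\<in>path_crystal \<alpha> \<pi>\<^sub>\<kappa>. \<forall>\<pi>'\<in>path_crystal \<alpha> \<pi>\<^sub>\<kappa>. \<forall>i.
         root_f \<alpha> 1 i \<pi> = Some \<pi>' \<longrightarrow> pmf p \<pi>' = pmf p \<pi> * \<tau> i))"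
    (is "central ?B _ \<longleftrightarrow> (\<exists>\<tau>. ?multiplicative \<tau>)")
proof -
  have \<Phi>: "root_system \<Phi>" using assms(1) by (simp add: irreducible_root_system_def)
  note \<alpha> = assms(2)
  note int = integral_path_elementary[OF \<Phi> \<alpha> assms(4)]
  have wt: "\<eta>' 1 = \<eta> 1 - \<alpha> i" if "\<eta> \<in> ?B" "root_f \<alpha> 1 i \<eta> = Some \<eta>'" for i \<eta> \<eta>'
    by (rule path_crystal_weight_step[OF \<Phi> \<alpha> int assms(6) that])
  have pos: "pmf p \<eta> > 0" if "\<eta> \<in> ?B" for \<eta> using assms(8) that by blast
  have "set_pmf p = ?B"
    using assms(7) pos by (force simp: set_pmf_iff)
  moreover have "\<eta> \<in> extensional {0..1} \<and> \<eta> 0 = 0" if "\<eta> \<in> ?B" for \<eta>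
    using path_crystal_integral(1)[OF \<Phi> \<alpha> int assms(6) that] by (simp add: integral_path_def)
  ultimately have central: "central ?B (product_law p) \<longleftrightarrow>
    (\<forall>l::nat\<ge>1. \<forall>\<omega>\<in>{..<l} \<rightarrow> ?B. \<forall>\<omega>'\<in>{..<l} \<rightarrow> ?B.
       (\<Sum>k<l. \<omega> k 1) = (\<Sum>k<l. \<omega>' k 1) \<longrightarrow> (\<Prod>k<l. pmf p (\<omega> k)) = (\<Prod>k<l. pmf p (\<omega>' k)))"
    by (rule central_iff)
  show ?thesis
  proof
    assume c: "central ?B (product_law p)"
    define arrow where "arrow i \<eta> \<eta>' \<longleftrightarrow> \<eta> \<in> ?B \<and> \<eta>' \<in> ?B \<and> root_f \<alpha> 1 i \<eta> = Some \<eta>'" for i \<eta> \<eta>'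
    \<comment> \<open>Each of the two words of length 2 contains exactly one target of an
      \<open>i\<close>-arrow, so both have the same weight.\<close>
    have swap: "pmf p \<eta> * pmf p \<zeta>' = pmf p \<eta>' * pmf p \<zeta>"
      if "arrow i \<eta> \<eta>'" "arrow i \<zeta> \<zeta>'" for i \<eta> \<eta>' \<zeta> \<zeta>'
    proof -
      let ?\<omega> = "\<lambda>k::nat. if k = 0 then \<eta> else \<zeta>'" and ?\<omega>' = "\<lambda>k::nat. if k = 0 then \<eta>' else \<zeta>"
      have "(\<Sum>k<2. ?\<omega> k 1) = (\<Sum>k<2. ?\<omega>' k 1)"
        using that wt[of \<eta> i \<eta>'] wt[of \<zeta> i \<zeta>'] by (simp add: arrow_def numeral_2_eq_2)
      then have "(\<Prod>k<2. pmf p (?\<omega> k)) = (\<Prod>k<2. pmf p (?\<omega>' k))"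
        using that by (intro c[unfolded central, rule_format]) (auto simp: arrow_def)
      then show ?thesis by (simp add: numeral_2_eq_2)
    qed
    have "\<exists>t>0. \<forall>\<eta> \<eta>'. arrow i \<eta> \<eta>' \<longrightarrow> pmf p \<eta>' = pmf p \<eta> * t" for i
    proof (cases "\<exists>\<zeta> \<zeta>'. arrow i \<zeta> \<zeta>'")
      case True
      then obtain \<zeta> \<zeta>' where \<zeta>: "arrow i \<zeta> \<zeta>'" by blast
      then have "pmf p \<zeta> > 0" "pmf p \<zeta>' > 0" using pos by (auto simp: arrow_def)
      then show ?thesis
        using swap[OF _ \<zeta>] by (intro exI[of _ "pmf p \<zeta>' / pmf p \<zeta>"]) (simp add: field_simps)
    \<comment> \<open>A color without arrows imposes no condition, and the value 1 serves as a
      positive default.\<close>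
    qed (auto intro: exI[of _ 1])
    then obtain \<tau> where "\<And>i. \<tau> i > 0 \<and> (\<forall>\<eta> \<eta>'. arrow i \<eta> \<eta>' \<longrightarrow> pmf p \<eta>' = pmf p \<eta> * \<tau> i)"
      by metis
    then show "\<exists>\<tau>. ?multiplicative \<tau>"
      unfolding arrow_def by (intro exI[of _ \<tau>]) blast
  next
    assume "\<exists>\<tau>. ?multiplicative \<tau>"
    then obtain \<tau> where \<tau>: "?multiplicative \<tau>" by blast
    \<comment> \<open>\<open>c i\<close> counts the uses of the operator of color \<open>i\<close>
      on a way from \<open>\<pi>\<^sub>\<kappa>\<close> to \<open>\<eta>\<close>; the same exponents
      govern the endpoint and the probability.\<close>
    have "\<exists>c :: 'n \<Rightarrow> nat. \<eta> 1 = \<kappa> - (\<Sum>i\<in>UNIV. real (c i) *\<^sub>R \<alpha> i) \<and>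
        pmf p \<eta> = pmf p \<pi>\<^sub>\<kappa> * (\<Prod>i\<in>UNIV. \<tau> i ^ c i)" if "\<eta> \<in> ?B" for \<eta>
      using that
    proof induction
      case start
      then show ?case by (intro exI[of _ "\<lambda>_. 0"]) (simp add: assms(5))
    next
      case (step \<eta> i \<eta>')
      then obtain c :: "'n \<Rightarrow> nat" where c: "\<eta> 1 = \<kappa> - (\<Sum>i\<in>UNIV. real (c i) *\<^sub>R \<alpha> i)"
        "pmf p \<eta> = pmf p \<pi>\<^sub>\<kappa> * (\<Prod>i\<in>UNIV. \<tau> i ^ c i)" by blast
      have "\<eta>' \<in> ?B" using step.hyps by (rule path_crystal.step)
      then have "pmf p \<eta>' = pmf p \<eta> * \<tau> i" using \<tau> step.hyps by blast
      moreover have "(\<Prod>k\<in>UNIV. \<tau> k ^ (c(i := Suc (c i))) k) = (\<Prod>k\<in>UNIV. \<tau> k ^ c k) * \<tau> i"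
        by (simp add: prod.remove[of UNIV i] mult.commute)
      moreover have "(\<Sum>k\<in>UNIV. real ((c(i := Suc (c i))) k) *\<^sub>R \<alpha> k) = (\<Sum>k\<in>UNIV. real (c k) *\<^sub>R \<alpha> k) + \<alpha> i"
        by (simp add: sum.remove[of UNIV i] scaleR_add_left)
      ultimately show ?case
        using c wt[OF step.hyps] by (intro exI[of _ "c(i := Suc (c i))"]) simp
    qed
    then obtain c :: "'v lpath \<Rightarrow> 'n \<Rightarrow> nat" where
      c1: "\<And>\<eta>. \<eta> \<in> ?B \<Longrightarrow> \<eta> 1 = \<kappa> - (\<Sum>i\<in>UNIV. real (c \<eta> i) *\<^sub>R \<alpha> i)" and
      c2: "\<And>\<eta>. \<eta> \<in> ?B \<Longrightarrow> pmf p \<eta> = pmf p \<pi>\<^sub>\<kappa> * (\<Prod>i\<in>UNIV. \<tau> i ^ c \<eta> i)"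
      by metis
    have wt_sum: "(\<Sum>k<l. \<omega> k 1) = real l *\<^sub>R \<kappa> - (\<Sum>i\<in>UNIV. real (\<Sum>k<l. c (\<omega> k) i) *\<^sub>R \<alpha> i)"
      and pmf_prod: "(\<Prod>k<l. pmf p (\<omega> k)) = pmf p \<pi>\<^sub>\<kappa> ^ l * (\<Prod>i\<in>UNIV. \<tau> i ^ (\<Sum>k<l. c (\<omega> k) i))"
      if \<omega>: "\<omega> \<in> {..<l} \<rightarrow> ?B" for l \<omega>
    proof -
      have "(\<Sum>k<l. \<omega> k 1) = (\<Sum>k<l. \<kappa> - (\<Sum>i\<in>UNIV. real (c (\<omega> k) i) *\<^sub>R \<alpha> i))"
        using \<omega> by (intro sum.cong refl c1) auto
      also have "\<dots> = real l *\<^sub>R \<kappa> - (\<Sum>k<l. \<Sum>i\<in>UNIV. real (c (\<omega> k) i) *\<^sub>R \<alpha> i)"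
        by (simp add: sum_subtractf sum_constant_scaleR)
      also have "(\<Sum>k<l. \<Sum>i\<in>UNIV. real (c (\<omega> k) i) *\<^sub>R \<alpha> i) = (\<Sum>i\<in>UNIV. real (\<Sum>k<l. c (\<omega> k) i) *\<^sub>R \<alpha> i)"
        by (subst sum.swap) (simp add: scaleR_left.sum)
      finally show "(\<Sum>k<l. \<omega> k 1) = real l *\<^sub>R \<kappa> - (\<Sum>i\<in>UNIV. real (\<Sum>k<l. c (\<omega> k) i) *\<^sub>R \<alpha> i)" .
      have "(\<Prod>k<l. pmf p (\<omega> k)) = (\<Prod>k<l. pmf p \<pi>\<^sub>\<kappa> * (\<Prod>i\<in>UNIV. \<tau> i ^ c (\<omega> k) i))"
        using \<omega> by (intro prod.cong refl c2) auto
      also have "\<dots> = pmf p \<pi>\<^sub>\<kappa> ^ l * (\<Prod>k<l. \<Prod>i\<in>UNIV. \<tau> i ^ c (\<omega> k) i)"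
        by (simp add: prod.distrib)
      also have "(\<Prod>k<l. \<Prod>i\<in>UNIV. \<tau> i ^ c (\<omega> k) i) = (\<Prod>i\<in>UNIV. \<tau> i ^ (\<Sum>k<l. c (\<omega> k) i))"
        by (subst prod.swap) (simp add: power_sum)
      finally show "(\<Prod>k<l. pmf p (\<omega> k)) = pmf p \<pi>\<^sub>\<kappa> ^ l * (\<Prod>i\<in>UNIV. \<tau> i ^ (\<Sum>k<l. c (\<omega> k) i))" .
    qed
    show "central ?B (product_law p)"
      unfolding central
    proof (intro allI impI ballI)
      fix l :: nat and \<omega> \<omega>' assume \<omega>: "\<omega> \<in> {..<l} \<rightarrow> ?B" "\<omega>' \<in> {..<l} \<rightarrow> ?B"
        and eq: "(\<Sum>k<l. \<omega> k 1) = (\<Sum>k<l. \<omega>' k 1)"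
      have "(\<Sum>i\<in>UNIV. real (\<Sum>k<l. c (\<omega> k) i) *\<^sub>R \<alpha> i) = (\<Sum>i\<in>UNIV. real (\<Sum>k<l. c (\<omega>' k) i) *\<^sub>R \<alpha> i)"
        using eq unfolding wt_sum[OF \<omega>(1)] wt_sum[OF \<omega>(2)] by simp
      \<comment> \<open>Linear independence of the simple roots recovers the total exponents from
        the common weight.\<close>
      then have "(\<lambda>i. real (\<Sum>k<l. c (\<omega> k) i)) = (\<lambda>i. real (\<Sum>k<l. c (\<omega>' k) i))"
        by (rule independent_family_eq[OF simple_roots_indep[OF \<Phi> \<alpha>]])
      then have "(\<Sum>k<l. c (\<omega> k) i) = (\<Sum>k<l. c (\<omega>' k) i)" for i
        by (metis of_nat_eq_iff)
      then show "(\<Prod>k<l. pmf p (\<omega> k)) = (\<Prod>k<l. pmf p (\<omega>' k))"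
        unfolding pmf_prod[OF \<omega>(1)] pmf_prod[OF \<omega>(2)] by simp
    qed
  qed
qed

end
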